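(* Let $G$ be an $(n,d,\lambda)$-graph and $U$ a subset of vertices with $|U|\gg \lambda(n/d)^{3/2}$. Then there is a subset $U'\subset U$ with $|U'|=(1-o(1))|U|$ such that \[\left|H_3^+(U')-\frac{H_3(U')d}{n}\right|\ll \lambda\left(H_2(U')\frac{|U'|d}{n}\right)^{1/2}\left(\frac{|U'|^6d^8}{n^8}+\lambda H_2(U')\right)^{1/2}.\]
   Context: An $(n,d,\lambda)$-graph is a $d$-regular graph on $n$ vertices all of whose adjacency eigenvalues other than the largest have absolute value at most $\lambda$; $u\sim v$ denotes adjacency. For $W\subset V(G)$ (all tuples below are not necessarily of distinct vertices): $H_2(W)$ is the number of $5$-tuples $(x,y,z,u,v)\in W^5$ with $x\sim u$, $u\sim z$, $z\sim y$, $x\sim y$, $u\sim v$, $v\sim y$; $H_3(W)$ is the number of $7$-tuples $(x,y,z,u,v,u',x')\in W^7$ with $x\sim y$, $y\sim z$, $z\sim u$, $u\sim x$, $u\sim v$, $v\sim u'$, $u'\sim z$, $u'\sim x'$, $x'\sim y$; $H_3^+(W)$ is the number of such $7$-tuples satisfying in addition $x\sim u'$. Asymptotic notation refers to $n\to\infty$; $f\ll g$ means $f=O(g)$ and $f\gg g$ means $f=\Omega(g)$. *)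

theory Defs
  imports
    Complex_Main
    "Jordan_Normal_Form.Char_Poly"
    "Graph_Theory.Digraph"
begin

definition adjacency_matrix :: "('a, 'b) pre_digraph \<Rightarrow> 'a list \<Rightarrow> real mat" where
  "adjacency_matrix G vs =
     mat (length vs) (length vs) (\<lambda>(i, j). if vs ! i \<rightarrow>\<^bsub>G\<^esub> vs ! j then 1 else 0)"

text \<open>The eigenvalues are counted with multiplicity. Reordering the vertices conjugates the
  adjacency matrix by a permutation matrix, so the choice of enumeration is immaterial. The matrix
  is real symmetric, so its characteristic polynomial splits over the reals and has as many real
  roots, with multiplicity, as \<^term>\<open>G\<close> has vertices.\<close>

definition adjacency_eigenvalues :: "('a, 'b) pre_digraph \<Rightarrow> real multiset" where
  "adjacency_eigenvalues G =
     proots (char_poly (adjacency_matrix G (SOME vs. set vs = verts G \<and> distinct vs)))"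

text \<open>Only one copy of the largest eigenvalue is exempt from the bound: if it has multiplicity
  at least two (that is, \<^term>\<open>G\<close> is disconnected), then it has to be at most \<^term>\<open>lam\<close> as well.\<close>

definition ndl_graph :: "('a, 'b) pre_digraph \<Rightarrow> nat \<Rightarrow> nat \<Rightarrow> real \<Rightarrow> bool" where
  "ndl_graph G n d lam \<longleftrightarrow>
     graph G \<and>
     card (verts G) = n \<and>
     (\<forall>v \<in> verts G. out_degree G v = d) \<and>
     (\<forall>\<mu> \<in># adjacency_eigenvalues G - {# Max_mset (adjacency_eigenvalues G) #}. \<bar>\<mu>\<bar> \<le> lam)"

definition H2 :: "('a, 'b) pre_digraph \<Rightarrow> 'a set \<Rightarrow> nat" where
  "H2 G W = card {(x, y, z, u, v). {x, y, z, u, v} \<subseteq> W \<and>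
     x \<rightarrow>\<^bsub>G\<^esub> u \<and> u \<rightarrow>\<^bsub>G\<^esub> z \<and> z \<rightarrow>\<^bsub>G\<^esub> y \<and> x \<rightarrow>\<^bsub>G\<^esub> y \<and> u \<rightarrow>\<^bsub>G\<^esub> v \<and> v \<rightarrow>\<^bsub>G\<^esub> y}"

definition H3 :: "('a, 'b) pre_digraph \<Rightarrow> 'a set \<Rightarrow> nat" where
  "H3 G W = card {(x, y, z, u, v, u', x'). {x, y, z, u, v, u', x'} \<subseteq> W \<and>
     x \<rightarrow>\<^bsub>G\<^esub> y \<and> y \<rightarrow>\<^bsub>G\<^esub> z \<and> z \<rightarrow>\<^bsub>G\<^esub> u \<and> u \<rightarrow>\<^bsub>G\<^esub> x \<and> u \<rightarrow>\<^bsub>G\<^esub> v \<and> v \<rightarrow>\<^bsub>G\<^esub> u' \<and>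
     u' \<rightarrow>\<^bsub>G\<^esub> z \<and> u' \<rightarrow>\<^bsub>G\<^esub> x' \<and> x' \<rightarrow>\<^bsub>G\<^esub> y}"

definition H3_plus :: "('a, 'b) pre_digraph \<Rightarrow> 'a set \<Rightarrow> nat" where
  "H3_plus G W = card {(x, y, z, u, v, u', x'). {x, y, z, u, v, u', x'} \<subseteq> W \<and>
     x \<rightarrow>\<^bsub>G\<^esub> y \<and> y \<rightarrow>\<^bsub>G\<^esub> z \<and> z \<rightarrow>\<^bsub>G\<^esub> u \<and> u \<rightarrow>\<^bsub>G\<^esub> x \<and> u \<rightarrow>\<^bsub>G\<^esub> v \<and> v \<rightarrow>\<^bsub>G\<^esub> u' \<and>
     u' \<rightarrow>\<^bsub>G\<^esub> z \<and> u' \<rightarrow>\<^bsub>G\<^esub> x' \<and> x' \<rightarrow>\<^bsub>G\<^esub> y \<and> x \<rightarrow>\<^bsub>G\<^esub> u'}"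

end

theory Submission
  imports Defs "HOL-Analysis.Convex"
begin

unbundle no inner_syntax

text \<open>
  The whole set \<open>U' = U\<close> works. Write \<open>A = p + B\<close> with \<open>p = d / n\<close>; the eigenvalue condition says that
  \<open>B\<close> has operator norm at most \<open>lam\<close>. Let \<open>c(u, v)\<close> be the codegree and \<open>t(y, u, v)\<close> the number of
  common neighbours of three vertices, all inside \<open>U\<close>. Then the deviation is
  \<open>\<Sum>\<^sub>y\<^sub>u\<^sub>v c(u, v) c(v, y) t (t - p c(y, u))\<close>, while \<open>H\<^sub>2 = \<Sum> c\<^sup>3\<close>. Put \<open>D = t - p c(y, u)\<close> and write
  \<open>t D = p c(y, u) D + D\<^sup>2\<close>. In the first term, mixing over \<open>v\<close> and Cauchy-Schwarz give the factor
  \<open>lam H\<^sub>2\<^sup>1\<^sup>/\<^sup>2\<close>. In the second, \<open>D\<close> is expanded in powers of \<open>B\<close>; the cubic term is controlled by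
  mixing over \<open>y\<close>, and the quadratic terms \<open>F = B\<^sup>2\<close> by comparing \<open>F\<close> with the codegree
  \<open>c(u, v) = p deg u + p deg v - p\<^sup>2 + F(u, v)\<close>.
  The hypothesis on \<open>|U|\<close> makes \<open>lam / |U|\<close> at most a constant times \<open>p\<^sup>3\<^sup>/\<^sup>2\<close>, which bounds the third and
  fourth moments of the degrees well enough although single degrees are not controlled.
\<close>

section \<open>The spectral norm of a symmetric matrix\<close>


lemma scalar_prod_Cauchy_Schwarz:
  fixes v w :: "real vec"
  assumes "v \<in> carrier_vec n" and "w \<in> carrier_vec n"
  shows "(v \<bullet> w)\<^sup>2 \<le> (v \<bullet> v) * (w \<bullet> w)"
  using Cauchy_Schwarz_ineq_sum[of "\<lambda>i. v $ i" "\<lambda>i. w $ i" "{0..<n}"] assms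
  by (simp add: scalar_prod_def power2_eq_square)

lemma scalar_prod_self_nonneg: "0 \<le> (v :: real vec) \<bullet> v"
  by (simp add: scalar_prod_def sum_nonneg)

text \<open>Cauchy-Schwarz in every row; the constant is the squared Frobenius norm. Its size is
  irrelevant: it makes a supremum finite and bounds an inverse matrix below.\<close>

lemma mult_mat_vec_bounded:
  fixes Q :: "real mat"
  assumes Q: "Q \<in> carrier_mat n n"
  obtains C where "0 \<le> C" and "\<And>v. v \<in> carrier_vec n \<Longrightarrow> (Q *\<^sub>v v) \<bullet> (Q *\<^sub>v v) \<le> C * (v \<bullet> v)"
proof
  let ?C = "\<Sum>i<n. row Q i \<bullet> row Q i"
  show "0 \<le> ?C" by (intro sum_nonneg scalar_prod_self_nonneg)
  fix v :: "real vec" assume v: "v \<in> carrier_vec n"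
  have "(Q *\<^sub>v v) \<bullet> (Q *\<^sub>v v) = (\<Sum>i<n. (row Q i \<bullet> v)\<^sup>2)"
    using Q by (simp add: scalar_prod_def[of "Q *\<^sub>v v"] power2_eq_square atLeast0LessThan)
  also have "\<dots> \<le> (\<Sum>i<n. (row Q i \<bullet> row Q i) * (v \<bullet> v))"
    using Q v by (intro sum_mono scalar_prod_Cauchy_Schwarz[of _ n]) auto
  finally show "(Q *\<^sub>v v) \<bullet> (Q *\<^sub>v v) \<le> ?C * (v \<bullet> v)"
    by (simp add: sum_distrib_right)
qed

text \<open>An argument by supremum instead of compactness. Let r be the supremum of |N v|^2 over
  unit vectors. Were r - N^2 invertible, boundedness of its inverse would keep |N v|^2 a fixed
  distance below r. So r is an eigenvalue of N^2, and factoring r - N^2 yields an eigenvalue sqrt r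
  or - sqrt r of N.\<close>

lemma symmetric_mat_norm_attained:
  fixes N :: "real mat"
  assumes N: "N \<in> carrier_mat n n" and sym: "transpose_mat N = N" and n: "0 < n"
  obtains \<mu> where "eigenvalue N \<mu>"
    and "\<And>v. v \<in> carrier_vec n \<Longrightarrow> (N *\<^sub>v v) \<bullet> (N *\<^sub>v v) \<le> \<mu>\<^sup>2 * (v \<bullet> v)"
proof -
  obtain C where C: "0 \<le> C" "\<And>v. v \<in> carrier_vec n \<Longrightarrow> (N *\<^sub>v v) \<bullet> (N *\<^sub>v v) \<le> C * (v \<bullet> v)"
    using mult_mat_vec_bounded[OF N] by blast
  define S where "S = {(N *\<^sub>v v) \<bullet> (N *\<^sub>v v) | v. v \<in> carrier_vec n \<and> v \<bullet> v = 1}"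
  define r where "r = Sup S"
  have bdd: "bdd_above S"
    using C by (intro bdd_aboveI[of _ C]) (auto simp: S_def, metis mult.right_neutral)
  have upper: "(N *\<^sub>v v) \<bullet> (N *\<^sub>v v) \<le> r" if "v \<in> carrier_vec n" "v \<bullet> v = 1" for v
    unfolding r_def using that by (intro cSup_upper bdd) (auto simp: S_def)
  have "unit_vec n 0 \<bullet> (unit_vec n 0 :: real vec) = 1" using n by simp
  then have S_ne: "S \<noteq> {}" and "0 \<le> r"
    using upper[of "unit_vec n 0"] scalar_prod_self_nonneg[of "N *\<^sub>v unit_vec n 0"]
    by (auto simp: S_def intro!: exI[of _ "unit_vec n 0"])
  have norm_le: "(N *\<^sub>v v) \<bullet> (N *\<^sub>v v) \<le> r * (v \<bullet> v)" if v: "v \<in> carrier_vec n" for v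
  proof (cases "v \<bullet> v = 0")
    case True
    then show ?thesis using C(2)[OF v] by simp
  next
    case False
    define a where "a = 1 / sqrt (v \<bullet> v)"
    have vv: "0 < v \<bullet> v" using False scalar_prod_self_nonneg[of v] by linarith
    have a: "a * a = 1 / (v \<bullet> v)" using vv by (simp add: a_def)
    have "(N *\<^sub>v (a \<cdot>\<^sub>v v)) \<bullet> (N *\<^sub>v (a \<cdot>\<^sub>v v)) \<le> r"
      using v vv a by (intro upper) (auto simp flip: mult.assoc)
    also have "N *\<^sub>v (a \<cdot>\<^sub>v v) = a \<cdot>\<^sub>v (N *\<^sub>v v)"
      using N v by (rule mult_mat_vec)
    finally have "(a * a) * ((N *\<^sub>v v) \<bullet> (N *\<^sub>v v)) \<le> r"
      using N v by (simp add: mult.assoc)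
    then show ?thesis using vv by (simp add: a field_simps)
  qed
  define q where "q = r \<cdot>\<^sub>m 1\<^sub>m n - N * N"
  have q: "q \<in> carrier_mat n n" unfolding q_def using N by (intro minus_carrier_mat mult_carrier_mat)
  have qv: "q *\<^sub>v v = r \<cdot>\<^sub>v v - N *\<^sub>v (N *\<^sub>v v)" if v: "v \<in> carrier_vec n" for v
  proof -
    have "q *\<^sub>v v = (r \<cdot>\<^sub>m 1\<^sub>m n) *\<^sub>v v - (N * N) *\<^sub>v v"
      unfolding q_def using N v by (intro minus_mult_distrib_mat_vec) auto
    also have "(r \<cdot>\<^sub>m 1\<^sub>m n) *\<^sub>v v = r \<cdot>\<^sub>v v"
      using v by (intro eq_vecI) auto
    finally show ?thesis using N v by simp
  qed
  have "det q = 0"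
  proof (rule ccontr)
    assume "det q \<noteq> 0"
    then obtain Q where Q: "Q \<in> carrier_mat n n" "Q * q = 1\<^sub>m n"
      using det_non_zero_imp_unit[OF q, of "()"] by (auto simp: Units_def ring_mat_def)
    obtain K where K: "0 \<le> K" "\<And>v. v \<in> carrier_vec n \<Longrightarrow> (Q *\<^sub>v v) \<bullet> (Q *\<^sub>v v) \<le> K * (v \<bullet> v)"
      using mult_mat_vec_bounded[OF Q(1)] by blast
    \<comment> \<open>The bounded inverse gives 1 \<le> K |q v|^2. Expanding |q v|^2 and using |N
      w|^2 \<le> r |w|^2 for w = N v leaves r (r - |N v|^2).\<close>
    have key: "1 \<le> K * r * (r - (N *\<^sub>v v) \<bullet> (N *\<^sub>v v))"
      if v: "v \<in> carrier_vec n" and v1: "v \<bullet> v = 1" for v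
    proof -
      define w where "w = N *\<^sub>v v"
      have w: "w \<in> carrier_vec n" "N *\<^sub>v w \<in> carrier_vec n" using N v by (auto simp: w_def)
      have vNw: "v \<bullet> (N *\<^sub>v w) = w \<bullet> w"
        using transpose_vec_mult_scalar[OF N w(1) v] by (simp add: sym w_def)
      have "(q *\<^sub>v v) \<bullet> (q *\<^sub>v v) = (r \<cdot>\<^sub>v v - N *\<^sub>v w) \<bullet> (r \<cdot>\<^sub>v v - N *\<^sub>v w)"
        using qv[OF v] by (simp add: w_def)
      also have "\<dots> = r\<^sup>2 - 2 * r * (w \<bullet> w) + (N *\<^sub>v w) \<bullet> (N *\<^sub>v w)"
        using v w v1 vNw comm_scalar_prod[OF w(2) v]
        by (simp add: minus_scalar_prod_distrib[of _ n] scalar_prod_minus_distrib[of _ n]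
            power2_eq_square)
      also have "\<dots> \<le> r\<^sup>2 - 2 * r * (w \<bullet> w) + r * (w \<bullet> w)"
        using norm_le[OF w(1)] by simp
      also have "\<dots> = r * (r - w \<bullet> w)"
        by (simp add: power2_eq_square algebra_simps)
      finally have le: "(q *\<^sub>v v) \<bullet> (q *\<^sub>v v) \<le> r * (r - w \<bullet> w)" .
      have "Q *\<^sub>v (q *\<^sub>v v) = v"
        using Q q v by (simp flip: assoc_mult_mat_vec)
      then have "1 \<le> K * ((q *\<^sub>v v) \<bullet> (q *\<^sub>v v))"
        using K(2)[of "q *\<^sub>v v"] q v v1 by simp
      also have "\<dots> \<le> K * (r * (r - w \<bullet> w))"
        using K(1) le by (intro mult_left_mono)
      finally show ?thesis by (simp add: w_def mult.assoc)
    qed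
    have Kr: "0 < K * r"
    proof -
      obtain v where v: "v \<in> carrier_vec n" "v \<bullet> v = (1::real)"
        using S_ne by (auto simp: S_def)
      have "K * r \<noteq> 0" using key[OF v] by auto
      then show ?thesis using K(1) \<open>0 \<le> r\<close> by (simp add: less_le)
    qed
    \<comment> \<open>By \<open>key\<close>, every element of \<open>S\<close> is at least 1 / (K r)
      below r, although r is the supremum.\<close>
    have "r \<le> r - 1 / (K * r)"
      unfolding r_def
    proof (rule cSup_least[OF S_ne], fold r_def)
      fix x assume "x \<in> S"
      then obtain v where v: "v \<in> carrier_vec n" "v \<bullet> v = 1" and x: "x = (N *\<^sub>v v) \<bullet> (N *\<^sub>v v)"
        by (auto simp: S_def)
      have "1 / (K * r) \<le> r - x"
        using key[OF v] Kr by (simp add: x pos_divide_le_eq mult.commute)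
      then show "x \<le> r - 1 / (K * r)" by simp
    qed
    then show False using Kr by simp
  qed
  then obtain v where v: "v \<in> carrier_vec n" "v \<noteq> 0\<^sub>v n" and "q *\<^sub>v v = 0\<^sub>v n"
    using det_0_iff_vec_prod_zero[OF q] by blast
  then have "r \<cdot>\<^sub>v v - N *\<^sub>v (N *\<^sub>v v) = 0\<^sub>v n" using qv by simp
  then have NNv: "N *\<^sub>v (N *\<^sub>v v) = r \<cdot>\<^sub>v v"
    using N v by (auto simp: vec_eq_iff)
  define s where "s = sqrt r"
  have s: "s * s = r" using \<open>0 \<le> r\<close> by (simp add: s_def)
  \<comment> \<open>(N - s) w = (N^2 - r) v = 0, so \<open>w\<close> is an eigenvector for
    \<open>s\<close> unless it vanishes; then \<open>v\<close> is one for
    \<open>- s\<close>.\<close>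
  define w where "w = N *\<^sub>v v + s \<cdot>\<^sub>v v"
  have w: "w \<in> carrier_vec n" using N v by (simp add: w_def)
  have "eigenvalue N s \<or> eigenvalue N (- s)"
  proof (cases "w = 0\<^sub>v n")
    case True
    have "N *\<^sub>v v = (- s) \<cdot>\<^sub>v v"
    proof (rule eq_vecI)
      fix i assume "i < dim_vec ((- s) \<cdot>\<^sub>v v)"
      then have i: "i < n" using v by simp
      have "(N *\<^sub>v v + s \<cdot>\<^sub>v v) $ i = 0" using True i by (simp add: w_def)
      then show "(N *\<^sub>v v) $ i = ((- s) \<cdot>\<^sub>v v) $ i" using i v N by simp
    qed (use N v in auto)
    then have "eigenvector N v (- s)" using N v by (simp add: eigenvector_def)
    then show ?thesis by (auto simp: eigenvalue_def)
  next
    case False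
    have "N *\<^sub>v w = N *\<^sub>v (N *\<^sub>v v) + N *\<^sub>v (s \<cdot>\<^sub>v v)"
      unfolding w_def using N v by (intro mult_add_distrib_mat_vec) auto
    also have "\<dots> = r \<cdot>\<^sub>v v + s \<cdot>\<^sub>v (N *\<^sub>v v)"
      using N v by (simp add: NNv mult_mat_vec)
    also have "\<dots> = s \<cdot>\<^sub>v w"
      using N v by (intro eq_vecI) (auto simp: w_def algebra_simps simp flip: s)
    finally have "eigenvector N w s" using N w False by (simp add: eigenvector_def)
    then show ?thesis by (auto simp: eigenvalue_def)
  qed
  moreover have "s\<^sup>2 = r" "(- s)\<^sup>2 = r" using s by (simp_all add: power2_eq_square)
  ultimately show ?thesis using that norm_le by metis
qed

section \<open>Determinants and characteristic polynomials under rank-one perturbation\<close>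

text \<open>Sylvester's determinant identity. The block matrix with rows (1, -U) and (V, 1) factors
  in two ways, with \<open>?L\<close> on the right and with \<open>?L\<close> on the left; the
  cofactors are block triangular and \<open>?L\<close> has determinant 1.\<close>

lemma det_one_plus_mult_commute:
  fixes U V :: "'a :: idom mat"
  assumes U: "U \<in> carrier_mat n m" and V: "V \<in> carrier_mat m n"
  shows "det (1\<^sub>m n + U * V) = det (1\<^sub>m m + V * U)"
proof -
  let ?L = "four_block_mat (1\<^sub>m n) (0\<^sub>m n m) V (1\<^sub>m m)"
  have UV: "U * V \<in> carrier_mat n n" "V * U \<in> carrier_mat m m"
    using U V by auto
  have "four_block_mat (1\<^sub>m n + U * V) (- U) (0\<^sub>m m n) (1\<^sub>m m) * ?L
      = four_block_mat ((1\<^sub>m n + U * V) * 1\<^sub>m n + - U * V) ((1\<^sub>m n + U * V) * 0\<^sub>m n m + - U * 1\<^sub>m m)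
         (0\<^sub>m m n * 1\<^sub>m n + 1\<^sub>m m * V) (0\<^sub>m m n * 0\<^sub>m n m + 1\<^sub>m m * 1\<^sub>m m)"
    by (rule mult_four_block_mat) (use U V UV in auto)
  also have "(1\<^sub>m n + U * V) * 1\<^sub>m n + - U * V = 1\<^sub>m n"
    using U V UV by (intro eq_matI) auto
  also have "(1\<^sub>m n + U * V) * 0\<^sub>m n m + - U * 1\<^sub>m m = - U"
    using U V UV by simp
  also have "0\<^sub>m m n * 1\<^sub>m n + 1\<^sub>m m * V = V"
    using V by simp
  also have "0\<^sub>m m n * 0\<^sub>m n m + 1\<^sub>m m * 1\<^sub>m m = (1\<^sub>m m :: 'a mat)"
    by simp
  finally have left: "four_block_mat (1\<^sub>m n + U * V) (- U) (0\<^sub>m m n) (1\<^sub>m m) * ?L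
      = four_block_mat (1\<^sub>m n) (- U) V (1\<^sub>m m)" .
  have "?L * four_block_mat (1\<^sub>m n) (- U) (0\<^sub>m m n) (1\<^sub>m m + V * U)
      = four_block_mat (1\<^sub>m n * 1\<^sub>m n + 0\<^sub>m n m * 0\<^sub>m m n) (1\<^sub>m n * - U + 0\<^sub>m n m * (1\<^sub>m m + V * U))
         (V * 1\<^sub>m n + 1\<^sub>m m * 0\<^sub>m m n) (V * - U + 1\<^sub>m m * (1\<^sub>m m + V * U))"
    by (rule mult_four_block_mat) (use U V UV in auto)
  also have "1\<^sub>m n * 1\<^sub>m n + 0\<^sub>m n m * 0\<^sub>m m n = (1\<^sub>m n :: 'a mat)"
    by simp
  also have "1\<^sub>m n * - U + 0\<^sub>m n m * (1\<^sub>m m + V * U) = - U"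
    using U V UV by simp
  also have "V * 1\<^sub>m n + 1\<^sub>m m * 0\<^sub>m m n = V"
    using V by simp
  also have "V * - U + 1\<^sub>m m * (1\<^sub>m m + V * U) = 1\<^sub>m m"
    using U V UV by (intro eq_matI) auto
  finally have "det (four_block_mat (1\<^sub>m n + U * V) (- U) (0\<^sub>m m n) (1\<^sub>m m) * ?L)
      = det (?L * four_block_mat (1\<^sub>m n) (- U) (0\<^sub>m m n) (1\<^sub>m m + V * U))"
    using left by simp
  moreover have "det ?L = 1"
    using V by (subst det_four_block_mat_upper_right_zero[of _ n _ m]) auto
  moreover have "det (four_block_mat (1\<^sub>m n + U * V) (- U) (0\<^sub>m m n) (1\<^sub>m m)) = det (1\<^sub>m n + U * V)"
    using U V by (subst det_four_block_mat_lower_left_zero[of _ n _ m]) auto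
  moreover have "det (four_block_mat (1\<^sub>m n) (- U) (0\<^sub>m m n) (1\<^sub>m m + V * U)) = det (1\<^sub>m m + V * U)"
    using U V by (subst det_four_block_mat_lower_left_zero[of _ n _ m]) auto
  ultimately show ?thesis
    using U V by (subst (asm) (1 2) det_mult[of _ "n + m"]) auto
qed

text \<open>The constant matrix is a column times a row, so Sylvester's identity reduces the claim
  to a 1 by 1 determinant.\<close>

lemma det_one_plus_const:
  fixes c :: "'a :: idom"
  shows "det (1\<^sub>m n + mat n n (\<lambda>_. c)) = 1 + of_nat n * c"
proof -
  let ?U = "mat n 1 (\<lambda>_. c)" and ?V = "mat 1 n (\<lambda>_. 1) :: 'a mat"
  have "mat n n (\<lambda>_. c) = ?U * ?V"
    by (intro eq_matI) (auto simp: scalar_prod_def)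
  then have "det (1\<^sub>m n + mat n n (\<lambda>_. c)) = det (1\<^sub>m 1 + ?V * ?U)"
    using det_one_plus_mult_commute[of ?U n 1 ?V] by simp
  also have "\<dots> = 1 + of_nat n * c"
    by (subst det_single) (auto simp: scalar_prod_def)
  finally show ?thesis .
qed

text \<open>The all-ones vector is an eigenvector for d; subtracting d / n from every entry moves
  this one root to 0 and keeps the others. Cross-multiplied linear factors avoid dividing
  polynomials.\<close>

lemma char_poly_subtract_const:
  fixes M :: "real mat"
  assumes M: "M \<in> carrier_mat n n" and n: "0 < n"
    and row_sum: "\<And>i. i < n \<Longrightarrow> (\<Sum>j<n. M $$ (i, j)) = d"
  shows "[:- d, 1:] * char_poly (mat n n (\<lambda>(i, j). M $$ (i, j) - d / n)) = [:0, 1:] * char_poly M"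
    (is "?f = ?g")
proof -
  let ?N = "mat n n (\<lambda>(i, j). M $$ (i, j) - d / n)"
  have eq: "poly ?f x = poly ?g x" if x: "x \<noteq> d" for x
  proof -
    define c where "c = d / (n * (x - d))"
    let ?J = "1\<^sub>m n + mat n n (\<lambda>_. c)"
    \<comment> \<open>Rows of x - M sum to x - d, so multiplying by the constant matrix c adds (x -
      d) c = d / n to every entry.\<close>
    have "- char_matrix ?N x = (- char_matrix M x) * ?J"
    proof (rule eq_matI)
      fix i j assume "i < dim_row (- char_matrix M x * ?J)" "j < dim_col (- char_matrix M x * ?J)"
      then have ij: "i < n" "j < n" using M by (auto simp: char_matrix_def)
      define a where "a k = (if i = k then x else 0) - M $$ (i, k)" for k
      have "((- char_matrix M x) * ?J) $$ (i, j) = (\<Sum>k<n. a k * ((if k = j then 1 else 0) + c))"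
        using M ij
        by (simp add: scalar_prod_def char_matrix_def a_def atLeast0LessThan flip: sum_negf)
          (intro sum.cong, auto simp: algebra_simps)
      also have "\<dots> = (\<Sum>k<n. (if k = j then a k else 0) + a k * c)"
        by (intro sum.cong) (auto simp: algebra_simps)
      also have "\<dots> = a j + (\<Sum>k<n. a k) * c"
        using ij by (simp add: sum.distrib sum_distrib_right)
      also have "(\<Sum>k<n. a k) = x - d"
        using ij row_sum[of i] by (simp add: a_def sum_subtractf)
      also have "(x - d) * c = d / n"
        using x n by (simp add: c_def)
      finally show "(- char_matrix ?N x) $$ (i, j) = ((- char_matrix M x) * ?J) $$ (i, j)"
        using M ij by (simp add: char_matrix_def a_def)
    qed (use M in \<open>auto simp: char_matrix_def\<close>)
    then have "det (- char_matrix ?N x) = det (- char_matrix M x) * det ?J"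
      using M by (simp add: det_mult[of _ n])
    also have "det ?J = x / (x - d)"
      using x n by (simp add: det_one_plus_const c_def field_simps)
    finally have "poly (char_poly ?N) x = poly (char_poly M) x * (x / (x - d))"
      unfolding char_poly_matrix[OF M] char_poly_matrix[OF mat_carrier] .
    then show ?thesis using x by (simp add: field_simps)
  qed
  \<comment> \<open>The two polynomials agree everywhere except possibly at d, hence at infinitely
    many points.\<close>
  show ?thesis
  proof (rule ccontr)
    assume "?f \<noteq> ?g"
    then have "finite {x. poly (?f - ?g) x = 0}"
      by (intro poly_roots_finite) simp
    moreover have "- {d} \<subseteq> {x. poly (?f - ?g) x = 0}"
      using eq by auto
    ultimately have "finite (- {d})" by (rule rev_finite_subset)
    then show False using infinite_UNIV_char_0[where 'a = real] by simp
  qed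
qed

section \<open>Mixing in graphs with a spectral gap\<close>

text \<open>Without parallel arcs, \<open>head\<close> is a bijection from out-arcs to
  out-neighbours.\<close>

lemma (in graph) sum_dominates_eq_out_degree:
  assumes "v \<in> verts G"
  shows "(\<Sum>y\<in>verts G. of_bool (v \<rightarrow>\<^bsub>G\<^esub> y)) = real (out_degree G v)"
proof -
  have "head G ` out_arcs G v = {y \<in> verts G. v \<rightarrow>\<^bsub>G\<^esub> y}"
    by (auto simp: arcs_ends_conv)
  moreover have "inj_on (head G) (out_arcs G v)"
    by (intro inj_onI no_multi_arcs) (auto simp: arc_to_ends_def)
  ultimately have "card {y \<in> verts G. v \<rightarrow>\<^bsub>G\<^esub> y} = out_degree G v"
    using card_image unfolding out_degree_def by metis
  then show ?thesis
    by (simp add: sum_of_bool_eq Int_def)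
qed

text \<open>Maximum principle: the eigenvector equation is read off at a coordinate of largest
  absolute value.\<close>

lemma regular_eigenvalue_le:
  fixes M :: "real mat"
  assumes M: "M \<in> carrier_mat n n" and nonneg: "\<And>i j. i < n \<Longrightarrow> j < n \<Longrightarrow> 0 \<le> M $$ (i, j)"
    and row_sum: "\<And>i. i < n \<Longrightarrow> (\<Sum>j<n. M $$ (i, j)) = d"
    and ev: "eigenvalue M x"
  shows "x \<le> d"
proof -
  obtain v where v: "v \<in> carrier_vec n" "v \<noteq> 0\<^sub>v n" "M *\<^sub>v v = x \<cdot>\<^sub>v v"
    using ev M by (auto simp: eigenvalue_def eigenvector_def)
  have "\<exists>i<n. v $ i \<noteq> 0"
    using v by (metis eq_vecI index_zero_vec carrier_vecD)
  then obtain k where k: "k < n" "v $ k \<noteq> 0" by blast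
  define m where "m = Max ((\<lambda>i. \<bar>v $ i\<bar>) ` {..<n})"
  have le: "\<bar>v $ i\<bar> \<le> m" if "i < n" for i
    unfolding m_def using that by (intro Max_ge) auto
  have "m \<in> (\<lambda>i. \<bar>v $ i\<bar>) ` {..<n}"
    unfolding m_def using k by (intro Max_in) auto
  then obtain i where i: "i < n" "m = \<bar>v $ i\<bar>" by auto
  have m: "0 < m" using le[OF k(1)] k(2) by linarith
  have "x * v $ i = (\<Sum>j<n. M $$ (i, j) * v $ j)"
  proof -
    have "x * v $ i = (M *\<^sub>v v) $ i" using v i by simp
    also have "\<dots> = (\<Sum>j<n. M $$ (i, j) * v $ j)"
      using M v(1) i by (simp add: scalar_prod_def atLeast0LessThan)
    finally show ?thesis .
  qed
  then have "\<bar>x\<bar> * m = \<bar>\<Sum>j<n. M $$ (i, j) * v $ j\<bar>"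
    by (simp add: i(2) flip: abs_mult)
  also have "\<dots> \<le> (\<Sum>j<n. \<bar>M $$ (i, j) * v $ j\<bar>)"
    by (rule sum_abs)
  also have "\<dots> \<le> (\<Sum>j<n. M $$ (i, j) * m)"
    using le nonneg i(1) by (intro sum_mono) (auto simp: abs_mult intro!: mult_left_mono)
  also have "\<dots> = d * m"
    using row_sum[OF i(1)] by (simp flip: sum_distrib_right)
  finally show ?thesis using m by (simp add: mult_le_cancel_right_pos)
qed

text \<open>Subtracting d / n from the adjacency matrix replaces one eigenvalue d by 0. The norm of
  the result is attained at an eigenvalue \<open>\<mu>\<close>, which is nonzero and hence among
  those that \<open>lam\<close> bounds. This also makes \<open>lam\<close> positive.\<close>

lemma ndl_graph_mixing:
  assumes G: "ndl_graph G n d lam" and d: "0 < d" and n: "0 < n"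
  shows "0 < lam"
    and "(\<Sum>x\<in>verts G. (\<Sum>y\<in>verts G. (of_bool (x \<rightarrow>\<^bsub>G\<^esub> y) - real d / real n) * f y)\<^sup>2)
      \<le> lam\<^sup>2 * (\<Sum>y\<in>verts G. (f y)\<^sup>2)"
proof -
  interpret graph G using G by (simp add: ndl_graph_def)
  define vs where "vs = (SOME vs. set vs = verts G \<and> distinct vs)"
  have vs: "set vs = verts G" "distinct vs"
    using someI_ex[OF finite_distinct_list[OF finite_verts]] by (auto simp: vs_def)
  have len: "length vs = n"
    using G vs distinct_card[of vs] by (simp add: ndl_graph_def)
  have sum_vs: "(\<Sum>x\<in>verts G. g x) = (\<Sum>i<n. g (vs ! i))" for g :: "_ \<Rightarrow> real"
    using sum.reindex_bij_betw[OF bij_betw_nth[OF vs(2) refl vs(1)[symmetric]], of g] len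
    by simp
  define M where "M = adjacency_matrix G vs"
  have M: "M \<in> carrier_mat n n"
    by (simp add: M_def adjacency_matrix_def len)
  have M_index: "M $$ (i, j) = of_bool (vs ! i \<rightarrow>\<^bsub>G\<^esub> vs ! j)" if "i < n" "j < n" for i j
    using that by (simp add: M_def adjacency_matrix_def len)
  have row_sum: "(\<Sum>j<n. M $$ (i, j)) = real d" if "i < n" for i
  proof -
    have "vs ! i \<in> verts G" using that len vs nth_mem by metis
    then show ?thesis
      using sum_dominates_eq_out_degree[of "vs ! i"] G that
      by (simp add: sum_vs M_index ndl_graph_def)
  qed
  define N where "N = mat n n (\<lambda>(i, j). M $$ (i, j) - real d / real n)"
  have N: "N \<in> carrier_mat n n" by (simp add: N_def)
  have adj_sym: "x \<rightarrow>\<^bsub>G\<^esub> y \<longleftrightarrow> y \<rightarrow>\<^bsub>G\<^esub> x" for x y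
    using arcs_ends_symmetric[OF sym_arcs] by blast
  have trans: "transpose_mat N = N"
  proof (rule eq_matI)
    fix i j assume "i < dim_row N" "j < dim_col N"
    then have "i < n" "j < n" using N by auto
    then show "transpose_mat N $$ (i, j) = N $$ (i, j)"
      using adj_sym[of "vs ! i" "vs ! j"] by (simp add: N_def M_index)
  qed (use N in auto)
  obtain \<mu> where ev: "eigenvalue N \<mu>"
    and bound: "\<And>v. v \<in> carrier_vec n \<Longrightarrow> (N *\<^sub>v v) \<bullet> (N *\<^sub>v v) \<le> \<mu>\<^sup>2 * (v \<bullet> v)"
    by (rule symmetric_mat_norm_attained[OF N trans n]) blast
  have mixing: "(\<Sum>x\<in>verts G. (\<Sum>y\<in>verts G. (of_bool (x \<rightarrow>\<^bsub>G\<^esub> y) - real d / real n) * f y)\<^sup>2)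
      \<le> \<mu>\<^sup>2 * (\<Sum>y\<in>verts G. (f y)\<^sup>2)" for f
  proof -
    define v where "v = vec n (\<lambda>i. f (vs ! i))"
    have v: "v \<in> carrier_vec n" by (simp add: v_def)
    have Nv: "(N *\<^sub>v v) $ i = (\<Sum>j<n. (of_bool (vs ! i \<rightarrow>\<^bsub>G\<^esub> vs ! j) - real d / real n) * f (vs ! j))"
      if "i < n" for i
      using that by (simp add: N_def v_def scalar_prod_def atLeast0LessThan M_index)
    have "(N *\<^sub>v v) \<bullet> (N *\<^sub>v v) = (\<Sum>i<n. ((N *\<^sub>v v) $ i)\<^sup>2)"
      using N by (simp add: scalar_prod_def[of "N *\<^sub>v v"] power2_eq_square atLeast0LessThan)
    moreover have "v \<bullet> v = (\<Sum>i<n. (f (vs ! i))\<^sup>2)"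
      by (simp add: scalar_prod_def v_def power2_eq_square atLeast0LessThan)
    ultimately show ?thesis
      using bound[OF v] by (simp add: sum_vs Nv)
  qed
  \<comment> \<open>Otherwise \<open>N\<close> would annihilate the indicator of a vertex; but there
    are no loops, so its diagonal entries are - d / n.\<close>
  have "\<mu> \<noteq> 0"
  proof
    assume "\<mu> = 0"
    obtain a where a: "a \<in> verts G"
      using G n by (metis all_not_in_conv card.empty less_irrefl ndl_graph_def)
    define g where "g x = (\<Sum>y\<in>verts G. (of_bool (x \<rightarrow>\<^bsub>G\<^esub> y) - real d / real n) * of_bool (y = a))" for x
    have "(\<Sum>x\<in>verts G. (g x)\<^sup>2) \<le> 0"
      using mixing[of "\<lambda>y. of_bool (y = a)"] \<open>\<mu> = 0\<close> by (simp add: g_def)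
    then have "(\<Sum>x\<in>verts G. (g x)\<^sup>2) = 0"
      by (intro antisym sum_nonneg) auto
    then have "g a = 0"
      using a by (simp add: sum_nonneg_eq_0_iff)
    moreover have "\<not> a \<rightarrow>\<^bsub>G\<^esub> a" using adj_not_same by blast
    then have "g a = - (real d / real n)"
      using a by (simp add: g_def of_bool_def if_distrib sum.delta cong: if_cong)
    ultimately show False using d n by simp
  qed
  define R where "R = proots (char_poly M)"
  have ne: "char_poly M \<noteq> 0" "char_poly N \<noteq> 0"
    using degree_monic_char_poly[OF M] degree_monic_char_poly[OF N] by auto
  have "[:- real d, 1:] * char_poly N = [:0, 1:] * char_poly M"
    unfolding N_def by (rule char_poly_subtract_const[OF M n row_sum])
  then have "proots ([:- real d, 1:] * char_poly N) = proots ([:0, 1:] * char_poly M)"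
    by (rule arg_cong)
  also have "proots ([:- real d, 1:] * char_poly N) = proots [:- real d, 1:] + proots (char_poly N)"
    using ne by (intro proots_mult) auto
  also have "proots ([:0, 1:] * char_poly M) = proots [:0, 1:] + R"
    unfolding R_def using ne by (intro proots_mult) auto
  finally have roots: "add_mset (real d) (proots (char_poly N)) = add_mset 0 R"
    by simp
  have dR: "real d \<in># R"
  proof -
    have "real d \<in># add_mset 0 R" unfolding roots[symmetric] by simp
    then show ?thesis using d by simp
  qed
  \<comment> \<open>The copy exempted in \<open>ndl_graph\<close> is thus the root that the
    subtraction moved to 0.\<close>
  have "Max_mset R = real d"
  proof (rule Max_eqI)
    fix x assume "x \<in> set_mset R"
    then have "eigenvalue M x"
      using ne eigenvalue_root_char_poly[OF M] by (simp add: R_def)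
    moreover have "0 \<le> M $$ (i, j)" if "i < n" "j < n" for i j
      using that by (simp add: M_index)
    ultimately show "x \<le> real d"
      using regular_eigenvalue_le[OF M _ row_sum] by blast
  qed (use dR in auto)
  moreover have "R = adjacency_eigenvalues G"
    unfolding R_def M_def vs_def adjacency_eigenvalues_def ..
  moreover have "\<mu> \<in># R - {#real d#}"
  proof -
    have "\<mu> \<in># proots (char_poly N)"
      using ev ne eigenvalue_root_char_poly[OF N] by simp
    moreover have "proots (char_poly N) = add_mset 0 (R - {#real d#})"
    proof -
      have "R = add_mset (real d) (R - {#real d#})" using dR by simp
      then have "add_mset (real d) (proots (char_poly N)) = add_mset (real d) (add_mset 0 (R - {#real d#}))"
        using roots by (metis add_mset_commute)
      then show ?thesis by simp
    qed
    ultimately show ?thesis using \<open>\<mu> \<noteq> 0\<close> by simp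
  qed
  ultimately have le: "\<bar>\<mu>\<bar> \<le> lam" using G by (simp add: ndl_graph_def)
  then show "0 < lam" using \<open>\<mu> \<noteq> 0\<close> by linarith
  have "\<mu>\<^sup>2 \<le> lam\<^sup>2" using le by (simp add: abs_le_square_iff[symmetric])
  then have "\<mu>\<^sup>2 * (\<Sum>y\<in>verts G. (f y)\<^sup>2) \<le> lam\<^sup>2 * (\<Sum>y\<in>verts G. (f y)\<^sup>2)"
    by (intro mult_right_mono sum_nonneg) auto
  with mixing[of f] show "(\<Sum>x\<in>verts G. (\<Sum>y\<in>verts G. (of_bool (x \<rightarrow>\<^bsub>G\<^esub> y) - real d / real n) * f y)\<^sup>2)
      \<le> lam\<^sup>2 * (\<Sum>y\<in>verts G. (f y)\<^sup>2)" by linarith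
qed

section \<open>Codegree estimates for mixing kernels\<close>

text \<open>The optimum is t = sqrt (b / a); when a or b is 0, a suitable t forces x \<le> 0.
  Cauchy-Schwarz can thus be used pointwise as a weighted AM-GM inequality, with the weight chosen
  once at the end.\<close>

lemma le_sqrt_if_le_all_weights:
  fixes x a b :: real
  assumes "\<And>t. 0 < t \<Longrightarrow> x \<le> t * a + b / t" and "0 \<le> a" and "0 \<le> b"
  shows "x \<le> 2 * sqrt (a * b)"
proof -
  consider "a = 0" | "b = 0" | "0 < a" "0 < b" using assms by linarith
  then show ?thesis
  proof cases
    case 1
    have "x \<le> 0"
    proof (rule ccontr)
      assume "\<not> x \<le> 0"
      then have x: "0 < x" by simp
      then have "x \<le> b / ((b + 1) / x)"
        using assms(1)[of "(b + 1) / x"] assms(3) 1 by simp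
      also have "\<dots> = b * x / (b + 1)" by simp
      finally have "x * (b + 1) \<le> b * x"
        using assms(3) by (simp add: pos_le_divide_eq)
      then show False using x by (simp add: algebra_simps)
    qed
    then show ?thesis using 1 by simp
  next
    case 2
    have "x \<le> 0"
    proof (rule ccontr)
      assume "\<not> x \<le> 0"
      then have x: "0 < x" by simp
      then have "x \<le> x / (a + 1) * a"
        using assms(1)[of "x / (a + 1)"] assms(2) 2 by simp
      then have "x * (a + 1) \<le> x * a"
        using assms(2) by (simp add: pos_le_divide_eq)
      then show False using x by (simp add: algebra_simps)
    qed
    then show ?thesis using 2 by simp
  next
    case 3
    have "sqrt (b / a) * a = sqrt (a * b)" "b / sqrt (b / a) = sqrt (a * b)"
      using 3 by (simp_all add: real_sqrt_divide real_sqrt_mult field_simps)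
    then show ?thesis using assms(1)[of "sqrt (b / a)"] 3 by simp
  qed
qed

text \<open>Sums over a vertex set \<^term>\<open>W\<close> are normalised to averages, so that \<^term>\<open>p\<close> is the edge
  density \<open>d / n\<close>, \<^term>\<open>l\<close> is \<open>lam / |W|\<close>, and \<^term>\<open>k\<close> depends on the constant in the lower bound
  on \<open>|W|\<close> only.\<close>

locale mixing_kernel =
  fixes W :: "'a set" and A :: "'a \<Rightarrow> 'a \<Rightarrow> real" and p l k :: real
  assumes finite_W: "finite W" and W_nonempty: "W \<noteq> {}"
    and A_cases: "A x y = 0 \<or> A x y = 1"
    and A_sym: "A x y = A y x"
    and p_pos: "0 < p" and p_le_1: "p \<le> 1" and l_pos: "0 < l" and k_ge_1: "1 \<le> k"
    and l_le_p: "l \<le> k * p" and l_sq_le: "l\<^sup>2 \<le> k\<^sup>2 * p ^ 3"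
    and mixing: "(\<Sum>x\<in>W. ((\<Sum>y\<in>W. (A x y - p) * f y) / card W)\<^sup>2) / card W
      \<le> l\<^sup>2 * ((\<Sum>y\<in>W. (f y)\<^sup>2) / card W)"
begin

definition avg :: "('a \<Rightarrow> real) \<Rightarrow> real" where
  "avg f = (\<Sum>x\<in>W. f x) / card W"

definition B :: "'a \<Rightarrow> 'a \<Rightarrow> real" where "B x y = A x y - p"
definition deg :: "'a \<Rightarrow> real" where "deg u = avg (A u)"
definition excess :: "'a \<Rightarrow> real" where "excess u = deg u - p"
definition codeg :: "'a \<Rightarrow> 'a \<Rightarrow> real" where "codeg u v = avg (\<lambda>x. A u x * A x v)"
text \<open>The normalised square of the kernel \<open>B\<close>; by \<open>codeg_eq\<close> it is
  what remains of the codegree beyond the degree terms.\<close>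

definition F :: "'a \<Rightarrow> 'a \<Rightarrow> real" where "F u v = avg (\<lambda>x. B u x * B x v)"
text \<open>\<open>G\<close> below is the part of \<open>codeg3\<close> that is cubic in
  \<open>B\<close>.\<close>

definition codeg3 :: "'a \<Rightarrow> 'a \<Rightarrow> 'a \<Rightarrow> real" where "codeg3 y u v = avg (\<lambda>z. A y z * A u z * A v z)"
definition G :: "'a \<Rightarrow> 'a \<Rightarrow> 'a \<Rightarrow> real" where "G y u v = avg (\<lambda>z. B y z * B u z * B v z)"

section \<open>Averages and elementary bounds\<close>

lemma card_W_pos: "real (card W) > 0"
  using finite_W W_nonempty by (simp add: card_gt_0_iff)

lemma avg_add: "avg (\<lambda>x. f x + g x) = avg f + avg g"
  by (simp add: avg_def sum.distrib add_divide_distrib)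

lemma avg_diff: "avg (\<lambda>x. f x - g x) = avg f - avg g"
  by (simp add: avg_def sum_subtractf diff_divide_distrib)

lemma avg_cmult: "avg (\<lambda>x. c * f x) = c * avg f"
  by (simp add: avg_def sum_distrib_left)

lemma avg_multc: "avg (\<lambda>x. f x * c) = avg f * c"
  by (simp add: avg_def sum_distrib_right)

lemma avg_divide: "avg (\<lambda>x. f x / c) = avg f / c"
  using avg_multc[of f "1 / c"] by simp

lemma avg_const: "avg (\<lambda>x. c) = c"
  using card_W_pos by (simp add: avg_def)

lemmas avg_linear = avg_add avg_diff avg_cmult avg_multc avg_divide avg_const

lemma avg_mono: "(\<And>x. f x \<le> g x) \<Longrightarrow> avg f \<le> avg g"
  by (auto simp: avg_def intro!: divide_right_mono sum_mono)

lemma avg_nonneg: "(\<And>x. 0 \<le> f x) \<Longrightarrow> 0 \<le> avg f"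
  by (auto simp: avg_def intro!: divide_nonneg_nonneg sum_nonneg)

lemma avg_swap: "avg (\<lambda>x. avg (\<lambda>y. f x y)) = avg (\<lambda>y. avg (\<lambda>x. f x y))"
  unfolding avg_def by (simp flip: sum_divide_distrib) (subst sum.swap, simp)

lemma avg_abs: "\<bar>avg f\<bar> \<le> avg (\<lambda>x. \<bar>f x\<bar>)"
  using card_W_pos by (auto simp: avg_def intro!: divide_right_mono sum_abs)

lemma avg_mixing: "avg (\<lambda>x. (avg (\<lambda>y. B x y * f y))\<^sup>2) \<le> l\<^sup>2 * avg (\<lambda>y. (f y)\<^sup>2)"
  using mixing[of f] by (simp add: avg_def B_def)

lemma A_nonneg: "0 \<le> A x y" and A_le_1: "A x y \<le> 1" and A_sq: "(A x y)\<^sup>2 = A x y"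
  using A_cases[of x y] by auto

lemma B_sym: "B x y = B y x"
  by (simp add: B_def A_sym[of x y])

lemma B_sq_le: "(B x y)\<^sup>2 \<le> A x y + p\<^sup>2"
proof -
  have "(1 - p)\<^sup>2 \<le> 1\<^sup>2"
    using p_pos p_le_1 by (intro power_mono) auto
  moreover have "0 \<le> p\<^sup>2" by simp
  ultimately show ?thesis
    using A_cases[of x y] by (auto simp: B_def intro: add_increasing2)
qed

lemma deg_nonneg: "0 \<le> deg u"
  unfolding deg_def by (intro avg_nonneg A_nonneg)

lemma deg_le_1: "deg u \<le> 1"
  using avg_mono[of "A u" "\<lambda>_. 1"] by (simp add: deg_def avg_const A_le_1)

lemma codeg_nonneg: "0 \<le> codeg u v"
  unfolding codeg_def by (intro avg_nonneg mult_nonneg_nonneg A_nonneg)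

lemma codeg_sym: "codeg u v = codeg v u"
  by (simp add: codeg_def A_sym[of _ v] A_sym[of u] mult.commute)

lemma codeg_le_deg: "codeg u v \<le> deg u"
  unfolding codeg_def deg_def
  by (intro avg_mono mult_right_le_one_le A_nonneg A_le_1)

lemma codeg_le_1: "codeg u v \<le> 1"
  using codeg_le_deg deg_le_1 order_trans by blast

lemma codeg3_nonneg: "0 \<le> codeg3 y u v"
  unfolding codeg3_def by (intro avg_nonneg mult_nonneg_nonneg A_nonneg)

lemma codeg3_le_codeg: "codeg3 y u v \<le> codeg y u"
  unfolding codeg3_def codeg_def A_sym[of _ u]
  by (intro avg_mono mult_right_le_one_le A_nonneg A_le_1 mult_nonneg_nonneg)

lemma F_sym: "F u v = F v u"
  by (simp add: F_def B_sym[of _ v] B_sym[of u] mult.commute)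

lemma G_sym: "G y u v = G u y v"
  by (simp add: G_def mult.commute)

section \<open>Degree excess and degree moments\<close>

lemma excess_eq: "excess u = avg (B u)"
  by (simp add: excess_def deg_def B_def[abs_def] avg_linear)

text \<open>Mixing applied to the constant function 1.\<close>

lemma excess_sq: "avg (\<lambda>u. (excess u)\<^sup>2) \<le> l\<^sup>2"
  using avg_mixing[of "\<lambda>_. 1"] by (simp add: excess_eq avg_const)

lemma excess_abs_le: "\<bar>excess u\<bar> \<le> 1"
  using deg_nonneg[of u] deg_le_1[of u] p_pos p_le_1 by (auto simp: excess_def)

lemma abs_avg_excess: "\<bar>avg excess\<bar> \<le> l"
proof -
  have "\<bar>avg excess\<bar> \<le> avg (\<lambda>u. \<bar>excess u\<bar>)"
    by (rule avg_abs)
  also have "\<dots> \<le> avg (\<lambda>u. l / 2 + (1 / (2 * l)) * (excess u)\<^sup>2)"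
  proof (rule avg_mono)
    fix u
    have "0 \<le> (l - \<bar>excess u\<bar>)\<^sup>2" by simp
    then have "2 * l * \<bar>excess u\<bar> \<le> l\<^sup>2 + (excess u)\<^sup>2"
      by (simp add: power2_diff algebra_simps)
    then show "\<bar>excess u\<bar> \<le> l / 2 + (1 / (2 * l)) * (excess u)\<^sup>2"
      using l_pos by (simp add: field_simps power2_eq_square)
  qed
  also have "\<dots> \<le> l / 2 + (1 / (2 * l)) * l\<^sup>2"
    using excess_sq l_pos by (auto simp: avg_linear intro!: mult_left_mono divide_right_mono)
  also have "\<dots> = l"
    using l_pos by (simp add: power2_eq_square)
  finally show ?thesis .
qed

lemma avg_deg: "avg deg = p + avg excess"
  by (simp add: excess_def[abs_def] avg_linear)

lemma k_pow_le: "i \<le> j \<Longrightarrow> k ^ i \<le> k ^ j"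
  using k_ge_1 by (intro power_increasing)

lemma p_pow_le: "i \<le> j \<Longrightarrow> p ^ j \<le> p ^ i"
  using p_pos p_le_1 by (intro power_decreasing) auto

text \<open>With \<open>k\<close> at least 1 and \<open>p\<close> at most 1, raising the exponent of
  \<open>k\<close> or lowering that of \<open>p\<close> only enlarges a monomial. This absorbs
  lower-order terms.\<close>

lemma mono_kp: "a \<le> b \<Longrightarrow> 0 \<le> b \<Longrightarrow> i \<le> i' \<Longrightarrow> j' \<le> j \<Longrightarrow> a * k ^ i * p ^ j \<le> b * k ^ i' * p ^ j'"
  using k_pow_le[of i i'] p_pow_le[of j' j] k_ge_1 p_pos
  by (intro mult_mono) auto

lemma deg_moment1: "avg deg \<le> 2 * k * p"
proof -
  have "p * 1 \<le> p * k" using p_pos k_ge_1 by (intro mult_left_mono) auto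
  then show ?thesis
    using abs_avg_excess l_le_p unfolding avg_deg by (simp add: algebra_simps)
qed

lemma deg_moment2: "avg (\<lambda>u. (deg u)\<^sup>2) \<le> 4 * k\<^sup>2 * p\<^sup>2"
proof -
  have "avg (\<lambda>u. (deg u)\<^sup>2) \<le> avg (\<lambda>u. 2 * p\<^sup>2 + 2 * (excess u)\<^sup>2)"
  proof (rule avg_mono)
    fix u
    have "0 \<le> (p - excess u)\<^sup>2" by simp
    moreover have "deg u = p + excess u" by (simp add: excess_def)
    ultimately show "(deg u)\<^sup>2 \<le> 2 * p\<^sup>2 + 2 * (excess u)\<^sup>2"
      by (simp only:) (simp add: power2_eq_square algebra_simps)
  qed
  also have "\<dots> \<le> 2 * p\<^sup>2 + 2 * (k\<^sup>2 * p ^ 3)"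
    using excess_sq l_sq_le by (simp add: avg_linear)
  also have "\<dots> \<le> 4 * k\<^sup>2 * p\<^sup>2"
    using mono_kp[of 2 2 0 2 2 2] mono_kp[of 2 2 2 2 2 3] by simp
  finally show ?thesis .
qed

text \<open>For excess e \<ge> 0, (p + e)^3 \<le> 4 p^3 + 4 e^3, and e \<le> 1 lowers e^3 to e^2,
  whose average is at most l^2. For negative excess the degree is below p.\<close>

lemma deg_moment3: "avg (\<lambda>u. deg u ^ 3) \<le> 8 * k\<^sup>2 * p ^ 3"
proof -
  have "avg (\<lambda>u. deg u ^ 3) \<le> avg (\<lambda>u. 4 * p ^ 3 + 4 * (excess u)\<^sup>2)"
  proof (rule avg_mono)
    fix u
    have d: "deg u = p + excess u" by (simp add: excess_def)
    show "deg u ^ 3 \<le> 4 * p ^ 3 + 4 * (excess u)\<^sup>2"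
    proof (cases "excess u \<ge> 0")
      case True
      have "0 \<le> 3 * (p + excess u) * (p - excess u)\<^sup>2" using True p_pos by simp
      also have "\<dots> = 4 * p ^ 3 + 4 * excess u ^ 3 - deg u ^ 3"
        unfolding d by (simp add: power2_eq_square power3_eq_cube algebra_simps)
      finally have "deg u ^ 3 \<le> 4 * p ^ 3 + 4 * excess u ^ 3" by simp
      moreover have "excess u ^ 3 \<le> excess u ^ 2"
        using True excess_abs_le[of u] by (intro power_decreasing) auto
      ultimately show ?thesis by simp
    next
      case False
      then have "deg u ^ 3 \<le> p ^ 3" using d deg_nonneg[of u] by (intro power_mono) auto
      moreover have "0 \<le> p ^ 3" "0 \<le> (excess u)\<^sup>2" using p_pos by auto
      ultimately show ?thesis by linarith
    qed
  qed
  also have "\<dots> \<le> 4 * p ^ 3 + 4 * (k\<^sup>2 * p ^ 3)"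
    using excess_sq l_sq_le by (simp add: avg_linear)
  also have "\<dots> \<le> 8 * k\<^sup>2 * p ^ 3"
    using mono_kp[of 4 4 0 2 3 3] by simp
  finally show ?thesis .
qed

text \<open>One power of \<^term>\<open>p\<close> is lost here against the regular case, because a few vertices may have
  degree density close to 1. The loss is affordable everywhere below, so such vertices need not
  be removed.\<close>

lemma deg_moment4: "avg (\<lambda>u. deg u ^ 4) \<le> 8 * k\<^sup>2 * p ^ 3"
proof -
  have "avg (\<lambda>u. deg u ^ 4) \<le> avg (\<lambda>u. deg u ^ 3)"
    using deg_nonneg deg_le_1 by (intro avg_mono power_decreasing) auto
  then show ?thesis using deg_moment3 by simp
qed

section \<open>Moments of four-cycle counts\<close>

text \<open>Split A = p + B: the constant part sees only the mean of f, and mixing controls the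
  rest.\<close>

lemma avg_A_sq:
  "avg (\<lambda>u. (avg (\<lambda>x. A u x * f x))\<^sup>2) \<le> 2 * p\<^sup>2 * (avg f)\<^sup>2 + 2 * l\<^sup>2 * avg (\<lambda>x. (f x)\<^sup>2)"
proof -
  have "avg (\<lambda>u. (avg (\<lambda>x. A u x * f x))\<^sup>2)
      \<le> avg (\<lambda>u. 2 * (p\<^sup>2 * (avg f)\<^sup>2) + 2 * (avg (\<lambda>x. B u x * f x))\<^sup>2)"
  proof (rule avg_mono)
    fix u
    have "avg (\<lambda>x. A u x * f x) = avg (\<lambda>x. p * f x + B u x * f x)"
      by (simp add: B_def algebra_simps)
    also have "\<dots> = p * avg f + avg (\<lambda>x. B u x * f x)"
      by (simp add: avg_linear)
    finally have e: "avg (\<lambda>x. A u x * f x) = p * avg f + avg (\<lambda>x. B u x * f x)" .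
    have "0 \<le> (p * avg f - avg (\<lambda>x. B u x * f x))\<^sup>2" by simp
    then show "(avg (\<lambda>x. A u x * f x))\<^sup>2
        \<le> 2 * (p\<^sup>2 * (avg f)\<^sup>2) + 2 * (avg (\<lambda>x. B u x * f x))\<^sup>2"
      unfolding e by (simp add: power2_eq_square algebra_simps)
  qed
  also have "\<dots> = 2 * p\<^sup>2 * (avg f)\<^sup>2 + 2 * avg (\<lambda>u. (avg (\<lambda>x. B u x * f x))\<^sup>2)"
    by (simp add: avg_linear)
  also have "\<dots> \<le> 2 * p\<^sup>2 * (avg f)\<^sup>2 + 2 * l\<^sup>2 * avg (\<lambda>x. (f x)\<^sup>2)"
    using avg_mixing[of f] by simp
  finally show ?thesis .
qed

text \<open>The normalised number of closed walks of length four at \<open>v\<close>.\<close>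

definition C4 :: "'a \<Rightarrow> real" where "C4 v = avg (\<lambda>u. (codeg u v)\<^sup>2)"

lemma C4_nonneg: "0 \<le> C4 v"
  unfolding C4_def by (intro avg_nonneg) simp

lemma C4_le: "C4 v \<le> 2 * p\<^sup>2 * (deg v)\<^sup>2 + 2 * l\<^sup>2 * deg v"
proof -
  have "avg (\<lambda>x. A x v) = deg v" "avg (\<lambda>x. (A x v)\<^sup>2) = deg v"
    unfolding deg_def by (simp_all add: A_sym[of _ v] A_sq)
  then show ?thesis
    using avg_A_sq[of "\<lambda>x. A x v"] by (simp add: C4_def codeg_def)
qed

lemma l_pow4_le: "l ^ 4 \<le> k ^ 4 * p ^ 6"
proof -
  have "(l\<^sup>2)\<^sup>2 \<le> (k\<^sup>2 * p ^ 3)\<^sup>2"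
    using l_sq_le by (intro power_mono) auto
  then show ?thesis by (simp add: power_mult_distrib flip: power_mult)
qed

text \<open>Squaring \<open>C4_le\<close> brings in the fourth and second degree moments. The fourth
  gives the exponent 7, where degrees all equal to p would give 8.\<close>

lemma avg_C4_sq: "avg (\<lambda>v. (C4 v)\<^sup>2) \<le> 96 * k ^ 6 * p ^ 7"
proof -
  have "avg (\<lambda>v. (C4 v)\<^sup>2) \<le> avg (\<lambda>v. 8 * p ^ 4 * deg v ^ 4 + 8 * l ^ 4 * (deg v)\<^sup>2)"
  proof (rule avg_mono)
    fix v
    have "(C4 v)\<^sup>2 \<le> (2 * p\<^sup>2 * (deg v)\<^sup>2 + 2 * l\<^sup>2 * deg v)\<^sup>2"
      using C4_le C4_nonneg by (intro power_mono) auto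
    also have "\<dots> \<le> 2 * (2 * p\<^sup>2 * (deg v)\<^sup>2)\<^sup>2 + 2 * (2 * l\<^sup>2 * deg v)\<^sup>2"
      using zero_le_power2[of "2 * p\<^sup>2 * (deg v)\<^sup>2 - 2 * l\<^sup>2 * deg v"]
      unfolding power2_sum power2_diff by linarith
    also have "\<dots> = 8 * p ^ 4 * deg v ^ 4 + 8 * l ^ 4 * (deg v)\<^sup>2"
      by (simp add: power_mult_distrib flip: power_mult)
    finally show "(C4 v)\<^sup>2 \<le> 8 * p ^ 4 * deg v ^ 4 + 8 * l ^ 4 * (deg v)\<^sup>2" .
  qed
  also have "\<dots> = 8 * p ^ 4 * avg (\<lambda>v. deg v ^ 4) + 8 * l ^ 4 * avg (\<lambda>v. (deg v)\<^sup>2)"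
    by (simp add: avg_linear)
  also have "\<dots> \<le> 8 * p ^ 4 * (8 * k\<^sup>2 * p ^ 3) + 8 * (k ^ 4 * p ^ 6) * (4 * k\<^sup>2 * p\<^sup>2)"
    using deg_moment4 deg_moment2 l_pow4_le p_pos k_ge_1
    by (intro add_mono mult_mono mult_nonneg_nonneg avg_nonneg) auto
  also have "\<dots> = 64 * k ^ 2 * p ^ 7 + 32 * k ^ 6 * p ^ 8"
    by (simp add: power_add[symmetric] eval_nat_numeral)
  also have "\<dots> \<le> 96 * k ^ 6 * p ^ 7"
    using mono_kp[of 64 64 2 6 7 7] mono_kp[of 32 32 6 6 7 8] by simp
  finally show ?thesis .
qed

lemma avg_C4_deg: "avg (\<lambda>v. C4 v * deg v) \<le> 24 * k ^ 4 * p ^ 5"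
proof -
  have "avg (\<lambda>v. C4 v * deg v) \<le> avg (\<lambda>v. 2 * p\<^sup>2 * deg v ^ 3 + 2 * l\<^sup>2 * (deg v)\<^sup>2)"
  proof (rule avg_mono)
    fix v
    show "C4 v * deg v \<le> 2 * p\<^sup>2 * deg v ^ 3 + 2 * l\<^sup>2 * (deg v)\<^sup>2"
      using mult_right_mono[OF C4_le[of v] deg_nonneg[of v]]
      by (simp add: algebra_simps power2_eq_square power3_eq_cube)
  qed
  also have "\<dots> = 2 * p\<^sup>2 * avg (\<lambda>v. deg v ^ 3) + 2 * l\<^sup>2 * avg (\<lambda>v. (deg v)\<^sup>2)"
    by (simp add: avg_linear)
  also have "\<dots> \<le> 2 * p\<^sup>2 * (8 * k\<^sup>2 * p ^ 3) + 2 * (k\<^sup>2 * p ^ 3) * (4 * k\<^sup>2 * p\<^sup>2)"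
    using deg_moment3 deg_moment2 l_sq_le p_pos k_ge_1 deg_nonneg
    by (intro add_mono mult_mono mult_nonneg_nonneg avg_nonneg) auto
  also have "\<dots> = 16 * k ^ 2 * p ^ 5 + 8 * k ^ 4 * p ^ 5"
    by (simp add: power_add[symmetric] eval_nat_numeral)
  also have "\<dots> \<le> 24 * k ^ 4 * p ^ 5"
    using mono_kp[of 16 16 2 4 5 5] by simp
  finally show ?thesis .
qed

lemma avg_C4: "avg C4 \<le> 12 * k ^ 3 * p ^ 4"
proof -
  have "avg C4 \<le> avg (\<lambda>v. 2 * p\<^sup>2 * (deg v)\<^sup>2 + 2 * l\<^sup>2 * deg v)"
    by (intro avg_mono C4_le)
  also have "\<dots> = 2 * p\<^sup>2 * avg (\<lambda>v. (deg v)\<^sup>2) + 2 * l\<^sup>2 * avg deg"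
    by (simp add: avg_linear)
  also have "\<dots> \<le> 2 * p\<^sup>2 * (4 * k\<^sup>2 * p\<^sup>2) + 2 * (k\<^sup>2 * p ^ 3) * (2 * k * p)"
    using deg_moment2 deg_moment1 l_sq_le p_pos k_ge_1 deg_nonneg
    by (intro add_mono mult_mono mult_nonneg_nonneg avg_nonneg) auto
  also have "\<dots> = 8 * k ^ 2 * p ^ 4 + 4 * k ^ 3 * p ^ 4"
    by (simp add: power_add[symmetric] eval_nat_numeral)
  also have "\<dots> \<le> 12 * k ^ 3 * p ^ 4"
    using mono_kp[of 8 8 2 3 4 4] by simp
  finally show ?thesis .
qed

section \<open>Expansion of codegrees in powers of \<open>B\<close>\<close>

lemma avg_A_col: "avg (\<lambda>x. A x v) = deg v"
  by (simp add: deg_def A_sym[of _ v])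

lemma codeg_eq: "codeg u v = p * deg u + p * deg v - p\<^sup>2 + F u v"
proof -
  have "F u v = avg (\<lambda>x. A u x * A x v - p * A u x - p * A x v + p\<^sup>2)"
    by (simp add: F_def B_def algebra_simps power2_eq_square)
  also have "\<dots> = codeg u v - p * deg u - p * deg v + p\<^sup>2"
    by (simp add: avg_linear avg_A_col codeg_def) (simp add: deg_def)
  finally show ?thesis by simp
qed

lemma codeg3_minus_eq: "codeg3 y u v - p * codeg y u = avg (\<lambda>z. B v z * (A y z * A u z))"
proof -
  have "avg (\<lambda>z. B v z * (A y z * A u z))
      = avg (\<lambda>z. A y z * A u z * A v z - p * (A y z * A z u))"
    by (simp add: B_def A_sym[of _ u] algebra_simps)
  then show ?thesis by (simp add: avg_linear codeg3_def codeg_def)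
qed

text \<open>In \<open>codeg3_minus_eq\<close> the factor at \<open>v\<close> is already
  \<open>B\<close>; the other two are written as p + B and multiplied out.\<close>

lemma codeg3_minus_expand:
  "codeg3 y u v - p * codeg y u = p\<^sup>2 * excess v + p * F v y + p * F v u + G y u v"
proof -
  have "avg (\<lambda>z. B v z * (A y z * A u z))
      = avg (\<lambda>z. p\<^sup>2 * B v z + p * (B v z * B z y) + p * (B v z * B z u) + B y z * B u z * B v z)"
    by (simp add: B_def A_sym[of _ u] A_sym[of _ y] algebra_simps power2_eq_square)
  also have "\<dots> = p\<^sup>2 * excess v + p * F v y + p * F v u + G y u v"
    by (simp add: avg_linear F_def G_def excess_eq)
  finally show ?thesis by (simp add: codeg3_minus_eq)
qed

text \<open>For fixed \<open>y\<close>, \<open>u\<close>, mixing over \<open>v\<close> is tested on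
  the indicator of their common neighbourhood, whose mean is the codegree.\<close>

lemma codeg3_minus_sq: "avg (\<lambda>v. (codeg3 y u v - p * codeg y u)\<^sup>2) \<le> l\<^sup>2 * codeg y u"
proof -
  have "avg (\<lambda>z. (A y z * A u z)\<^sup>2) = codeg y u"
    by (simp add: codeg_def A_sym[of _ u] power_mult_distrib A_sq)
  then show ?thesis
    using avg_mixing[of "\<lambda>z. A y z * A u z"] by (simp add: codeg3_minus_eq)
qed

lemma F_sq: "avg (\<lambda>v. (F u v)\<^sup>2) \<le> l\<^sup>2 * (deg u + p\<^sup>2)"
proof -
  have "avg (\<lambda>v. (F u v)\<^sup>2) \<le> l\<^sup>2 * avg (\<lambda>x. (B u x)\<^sup>2)"
    using avg_mixing[of "B u"] by (simp add: F_def B_sym mult.commute)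
  also have "\<dots> \<le> l\<^sup>2 * avg (\<lambda>x. A u x + p\<^sup>2)"
    by (intro mult_left_mono avg_mono B_sq_le) simp
  also have "\<dots> = l\<^sup>2 * (deg u + p\<^sup>2)"
    by (simp add: avg_linear) (simp add: deg_def)
  finally show ?thesis .
qed

text \<open>Mixing over \<open>y\<close> with test function \<open>B u z * B v z\<close>. By
  \<open>B_sq_le\<close> its square is at most (A + p^2)(A + p^2), which expands to the codegree and
  degree terms.\<close>

lemma G_sq: "avg (\<lambda>y. (G y u v)\<^sup>2) \<le> l\<^sup>2 * (codeg u v + p\<^sup>2 * deg u + p\<^sup>2 * deg v + p ^ 4)"
proof -
  have "avg (\<lambda>y. (G y u v)\<^sup>2) \<le> l\<^sup>2 * avg (\<lambda>z. (B u z * B v z)\<^sup>2)"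
    using avg_mixing[of "\<lambda>z. B u z * B v z"] by (simp add: G_def mult.assoc)
  also have "\<dots> \<le> l\<^sup>2 * avg (\<lambda>z. (A u z + p\<^sup>2) * (A v z + p\<^sup>2))"
    using A_nonneg
    by (intro mult_left_mono avg_mono) (auto simp: power_mult_distrib intro!: mult_mono B_sq_le)
  also have "(\<lambda>z. (A u z + p\<^sup>2) * (A v z + p\<^sup>2))
      = (\<lambda>z. A u z * A z v + p\<^sup>2 * A u z + p\<^sup>2 * A v z + p ^ 4)"
    by (simp add: fun_eq_iff algebra_simps A_sym[of _ v] flip: power_add)
  also have "avg \<dots> = codeg u v + p\<^sup>2 * deg u + p\<^sup>2 * deg v + p ^ 4"
    by (simp add: avg_linear codeg_def) (simp add: deg_def)
  finally show ?thesis .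
qed

section \<open>Walks of length two, counted by \<open>P\<close>\<close>

definition P :: "'a \<Rightarrow> real" where "P v = avg (codeg v)"

lemma P_nonneg: "0 \<le> P v"
  unfolding P_def by (intro avg_nonneg codeg_nonneg)

text \<open>\<open>P v\<close> sums degrees over the neighbours of \<open>v\<close>. The bound
  excess \<le> p + excess^2 / p charges a neighbour of large degree to the mean square of the excess
  over all vertices, which is at most l^2.\<close>

lemma P_le: "P v \<le> 2 * p * deg v + l\<^sup>2 / p"
proof -
  have "P v = avg (\<lambda>x. A v x * deg x)"
    unfolding P_def codeg_def by (subst avg_swap) (simp add: avg_cmult deg_def)
  also have "\<dots> \<le> avg (\<lambda>x. 2 * p * A v x + (excess x)\<^sup>2 / p)"
  proof (rule avg_mono)
    fix x
    have "0 \<le> (2 * p - excess x)\<^sup>2 + 3 * (excess x)\<^sup>2" by simp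
    then have "excess x \<le> p + (excess x)\<^sup>2 / p"
      using p_pos by (simp add: field_simps power2_eq_square)
    moreover have "deg x = p + excess x" by (simp add: excess_def)
    moreover have "0 \<le> (excess x)\<^sup>2 / p" using p_pos by simp
    ultimately show "A v x * deg x \<le> 2 * p * A v x + (excess x)\<^sup>2 / p"
      using A_cases[of v x] by auto
  qed
  also have "\<dots> = 2 * p * deg v + avg (\<lambda>x. (excess x)\<^sup>2) / p"
    by (simp add: avg_linear) (simp add: deg_def)
  also have "\<dots> \<le> 2 * p * deg v + l\<^sup>2 / p"
    using excess_sq p_pos by (simp add: divide_right_mono)
  finally show ?thesis .
qed

lemma l_sq_over_p: "l\<^sup>2 / p \<le> k\<^sup>2 * p\<^sup>2"
  using l_sq_le p_pos by (simp add: pos_divide_le_eq power3_eq_cube power2_eq_square mult.assoc)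

lemma P_le_const: "P v \<le> 3 * k\<^sup>2 * p"
proof -
  have "2 * p * deg v \<le> 2 * p * 1"
    using p_pos deg_le_1 by (intro mult_left_mono) auto
  then show ?thesis
    using P_le[of v] l_sq_over_p mono_kp[of 2 2 0 2 1 1] mono_kp[of 1 1 2 2 1 2] by simp
qed

lemma avg_P: "avg P \<le> 5 * k\<^sup>2 * p\<^sup>2"
proof -
  have "avg P \<le> avg (\<lambda>v. 2 * p * deg v + l\<^sup>2 / p)"
    by (intro avg_mono P_le)
  also have "\<dots> = 2 * p * avg deg + l\<^sup>2 / p"
    by (simp add: avg_linear)
  also have "\<dots> \<le> 2 * p * (2 * k * p) + k\<^sup>2 * p\<^sup>2"
    using deg_moment1 l_sq_over_p p_pos by (intro add_mono mult_left_mono) auto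
  also have "\<dots> \<le> 5 * k\<^sup>2 * p\<^sup>2"
    using mono_kp[of 4 4 1 2 2 2] by (simp add: power2_eq_square algebra_simps)
  finally show ?thesis .
qed

lemma avg_P_deg_sq: "avg (\<lambda>v. P v * (deg v)\<^sup>2) \<le> 20 * k ^ 4 * p ^ 4"
proof -
  have "avg (\<lambda>v. P v * (deg v)\<^sup>2) \<le> avg (\<lambda>v. 2 * p * deg v ^ 3 + (l\<^sup>2 / p) * (deg v)\<^sup>2)"
  proof (rule avg_mono)
    fix v
    show "P v * (deg v)\<^sup>2 \<le> 2 * p * deg v ^ 3 + (l\<^sup>2 / p) * (deg v)\<^sup>2"
      using mult_right_mono[OF P_le[of v], of "(deg v)\<^sup>2"]
      by (simp add: algebra_simps power2_eq_square power3_eq_cube)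
  qed
  also have "\<dots> = 2 * p * avg (\<lambda>v. deg v ^ 3) + (l\<^sup>2 / p) * avg (\<lambda>v. (deg v)\<^sup>2)"
    by (simp add: avg_add avg_cmult del: times_divide_eq_left)
  also have "\<dots> \<le> 2 * p * (8 * k\<^sup>2 * p ^ 3) + (k\<^sup>2 * p\<^sup>2) * (4 * k\<^sup>2 * p\<^sup>2)"
    using deg_moment3 deg_moment2 l_sq_over_p p_pos k_ge_1 deg_nonneg
    by (intro add_mono mult_mono mult_nonneg_nonneg avg_nonneg) auto
  also have "\<dots> = 16 * k ^ 2 * p ^ 4 + 4 * k ^ 4 * p ^ 4"
    by (simp add: power_add[symmetric] eval_nat_numeral)
  also have "\<dots> \<le> 20 * k ^ 4 * p ^ 4"
    using mono_kp[of 16 16 2 4 4 4] by simp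
  finally show ?thesis .
qed

section \<open>Averages of \<open>F\<close> squared against codegrees and degrees\<close>

text \<open>In the graph case this is \<open>H2\<close> divided by |W|^5.\<close>

definition h :: real where "h = avg (\<lambda>u. avg (\<lambda>v. codeg u v ^ 3))"

lemma h_nonneg: "0 \<le> h"
  unfolding h_def by (intro avg_nonneg) (simp add: codeg_nonneg)

lemma avg_deg_pow_F_sq:
  "avg (\<lambda>u. avg (\<lambda>v. deg u ^ i * (F u v)\<^sup>2))
    \<le> l\<^sup>2 * (avg (\<lambda>u. deg u ^ Suc i) + p\<^sup>2 * avg (\<lambda>u. deg u ^ i))"
proof -
  have "avg (\<lambda>u. avg (\<lambda>v. deg u ^ i * (F u v)\<^sup>2))
      \<le> avg (\<lambda>u. l\<^sup>2 * (deg u ^ Suc i + p\<^sup>2 * deg u ^ i))"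
  proof (rule avg_mono)
    fix u
    have "avg (\<lambda>v. deg u ^ i * (F u v)\<^sup>2) = deg u ^ i * avg (\<lambda>v. (F u v)\<^sup>2)"
      by (rule avg_cmult)
    also have "\<dots> \<le> deg u ^ i * (l\<^sup>2 * (deg u + p\<^sup>2))"
      using F_sq deg_nonneg by (intro mult_left_mono) auto
    finally show "avg (\<lambda>v. deg u ^ i * (F u v)\<^sup>2) \<le> l\<^sup>2 * (deg u ^ Suc i + p\<^sup>2 * deg u ^ i)"
      by (simp add: algebra_simps)
  qed
  then show ?thesis by (simp add: avg_add avg_cmult)
qed

text \<open>By \<open>codeg_eq\<close>, \<open>F\<close> is the codegree up to degree terms, so the
  weighted square is at most a multiple of the cubed codegree, averaging to \<open>h\<close>, plus
  terms in \<open>P\<close> and degrees.\<close>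

lemma avg_codeg_F_sq:
  "avg (\<lambda>u. avg (\<lambda>v. codeg u v * (F u v)\<^sup>2)) \<le> 3 * h + 255 * k ^ 4 * p ^ 6"
proof -
  have "avg (\<lambda>u. avg (\<lambda>v. codeg u v * (F u v)\<^sup>2))
      \<le> avg (\<lambda>u. avg (\<lambda>v. 3 * codeg u v ^ 3 + 6 * p\<^sup>2 * (codeg u v * (deg u)\<^sup>2)
          + 6 * p\<^sup>2 * (codeg v u * (deg v)\<^sup>2) + 3 * p ^ 4 * codeg u v))"
  proof (intro avg_mono)
    fix u v
    define a b c q where abc: "a = codeg u v" "b = p * deg u" "c = p * deg v" "q = p\<^sup>2"
    have F: "F u v = a - (b + c) + q"
      using codeg_eq[of u v] by (simp add: abc)
    \<comment> \<open>With s = b + c, the difference 3 (a^2 + s^2 + q^2) - F^2 is the sum of the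
      first three squares; the last one gives s^2 \<le> 2 b^2 + 2 c^2.\<close>
    have "0 \<le> (a + (b + c))\<^sup>2" "0 \<le> (a - q)\<^sup>2" "0 \<le> (b + c + q)\<^sup>2" "0 \<le> (b - c)\<^sup>2"
      by auto
    then have "(F u v)\<^sup>2 \<le> 3 * a\<^sup>2 + 6 * b\<^sup>2 + 6 * c\<^sup>2 + 3 * q\<^sup>2"
      unfolding F by (simp add: power2_eq_square algebra_simps)
    then have "a * (F u v)\<^sup>2 \<le> a * (3 * a\<^sup>2 + 6 * b\<^sup>2 + 6 * c\<^sup>2 + 3 * q\<^sup>2)"
      using codeg_nonneg[of u v] by (intro mult_left_mono) (auto simp: abc)
    then show "codeg u v * (F u v)\<^sup>2 \<le> 3 * codeg u v ^ 3 + 6 * p\<^sup>2 * (codeg u v * (deg u)\<^sup>2)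
          + 6 * p\<^sup>2 * (codeg v u * (deg v)\<^sup>2) + 3 * p ^ 4 * codeg u v"
      by (simp add: abc codeg_sym[of v u] power2_eq_square power3_eq_cube eval_nat_numeral algebra_simps)
  qed
  also have "\<dots> = 3 * h + 12 * p\<^sup>2 * avg (\<lambda>v. P v * (deg v)\<^sup>2) + 3 * p ^ 4 * avg P"
    using avg_swap[of "\<lambda>u v. codeg v u * (deg v)\<^sup>2"]
    by (simp add: avg_add avg_cmult avg_multc h_def P_def[abs_def])
  also have "\<dots> \<le> 3 * h + 12 * p\<^sup>2 * (20 * k ^ 4 * p ^ 4) + 3 * p ^ 4 * (5 * k\<^sup>2 * p\<^sup>2)"
    using avg_P_deg_sq avg_P p_pos by (intro add_mono mult_left_mono) auto
  also have "\<dots> = 3 * h + 240 * k ^ 4 * p ^ 6 + 15 * k\<^sup>2 * p ^ 6"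
    by (simp add: power_add[symmetric] eval_nat_numeral)
  also have "\<dots> \<le> 3 * h + 255 * k ^ 4 * p ^ 6"
    using mono_kp[of 15 15 2 4 6 6] by simp
  finally show ?thesis .
qed

text \<open>If \<^term>\<open>F u v\<close> is dominated by the degree terms or by \<^term>\<open>p\<^sup>2\<close>, so is the codegree. Otherwise the
  codegree is comparable to \<^term>\<open>F u v\<close>, and the weight \<^term>\<open>r\<close> splits off its cube.\<close>

lemma codeg_F_sq_deg_le:
  assumes "0 < r"
  shows "codeg u v * (F u v)\<^sup>2 * deg u
    \<le> 8 * p * ((deg u)\<^sup>2 * (F u v)\<^sup>2) + 8 * p * ((deg v)\<^sup>2 * (F u v)\<^sup>2)
      + 4 * p\<^sup>2 * (deg u * (F u v)\<^sup>2) + r * codeg u v ^ 3 + (4 / r) * (deg u ^ 3 * (F u v)\<^sup>2)"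
    (is "?lhs \<le> ?a + ?b + ?c + ?d + ?e")
proof -
  note nn = codeg_nonneg[of u v] deg_nonneg[of u] deg_nonneg[of v] p_pos assms
  have terms: "0 \<le> ?a" "0 \<le> ?b" "0 \<le> ?c" "0 \<le> ?d" "0 \<le> ?e"
    using nn by auto
  have codeg: "codeg u v = p * deg u + p * deg v - p\<^sup>2 + F u v" by (rule codeg_eq)
  have p2: "0 \<le> p\<^sup>2" by simp
  have pd: "0 \<le> p * deg u" "0 \<le> p * deg v" using nn by auto
  consider "\<bar>F u v\<bar> \<le> p * deg u + p * deg v"
    | "\<bar>F u v\<bar> > p * deg u + p * deg v" "F u v \<le> 2 * p\<^sup>2"
    | "\<bar>F u v\<bar> > p * deg u + p * deg v" "F u v > 2 * p\<^sup>2"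
    by linarith
  then show ?thesis
  proof cases
    case 1
    then have "codeg u v \<le> 2 * (p * deg u) + 2 * (p * deg v)"
      using codeg p2 by linarith
    then have "codeg u v \<le> 2 * p * (deg u + deg v)"
      by (simp add: algebra_simps)
    then have "?lhs \<le> 2 * p * (deg u + deg v) * (F u v)\<^sup>2 * deg u"
      using nn by (intro mult_right_mono) auto
    also have "\<dots> = 2 * p * (F u v)\<^sup>2 * ((deg u + deg v) * deg u)" by simp
    also have "\<dots> \<le> 2 * p * (F u v)\<^sup>2 * (4 * (deg u)\<^sup>2 + 4 * (deg v)\<^sup>2)"
    proof (intro mult_left_mono)
      have "0 \<le> (deg u - deg v)\<^sup>2 + 5 * (deg u)\<^sup>2 + 7 * (deg v)\<^sup>2" by simp
      then show "(deg u + deg v) * deg u \<le> 4 * (deg u)\<^sup>2 + 4 * (deg v)\<^sup>2"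
        by (simp add: power2_eq_square algebra_simps)
    qed (use nn in auto)
    also have "\<dots> = ?a + ?b" by (simp add: algebra_simps)
    finally show ?thesis using terms by linarith
  next
    case 2
    \<comment> \<open>A negative \<open>F\<close> of this size would make the codegree
      negative.\<close>
    have "F u v > p * deg u + p * deg v" using 2 codeg nn(1) pd p2 by linarith
    then have "codeg u v \<le> 4 * p\<^sup>2" using 2 codeg p2 by linarith
    then have "?lhs \<le> 4 * p\<^sup>2 * (F u v)\<^sup>2 * deg u"
      using nn by (intro mult_right_mono) auto
    also have "\<dots> = ?c" by simp
    finally show ?thesis using terms by linarith
  next
    case 3
    have F0: "0 \<le> F u v" and "F u v \<le> 2 * codeg u v" using 3 codeg p2 pd by linarith+
    have "codeg u v * F u v * deg u * F u v \<le> codeg u v * F u v * deg u * (2 * codeg u v)"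
      using nn F0 \<open>F u v \<le> 2 * codeg u v\<close> by (intro mult_left_mono) auto
    then have "r * ?lhs \<le> r * (2 * (codeg u v)\<^sup>2 * F u v * deg u)"
      using nn by (intro mult_left_mono) (auto simp: power2_eq_square algebra_simps)
    \<comment> \<open>AM-GM for r times the codegree against 2 F deg. Afterwards the codegree
      multiplying the second square is weakened to a degree.\<close>
    also have "\<dots> \<le> codeg u v * ((r * codeg u v)\<^sup>2 + 4 * (F u v * deg u)\<^sup>2)"
    proof -
      have "0 \<le> (r * codeg u v - 2 * (F u v * deg u))\<^sup>2 + 2 * r * codeg u v * (F u v * deg u)"
        using nn F0 by simp
      then have "2 * r * codeg u v * (F u v * deg u) \<le> (r * codeg u v)\<^sup>2 + 4 * (F u v * deg u)\<^sup>2"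
        by (simp add: power2_eq_square algebra_simps)
      from mult_left_mono[OF this nn(1)] show ?thesis
        by (simp add: power2_eq_square algebra_simps)
    qed
    also have "\<dots> = r\<^sup>2 * codeg u v ^ 3 + codeg u v * (4 * (F u v)\<^sup>2 * (deg u)\<^sup>2)"
      by (simp add: power2_eq_square power3_eq_cube algebra_simps)
    also have "\<dots> \<le> r\<^sup>2 * codeg u v ^ 3 + deg u * (4 * (F u v)\<^sup>2 * (deg u)\<^sup>2)"
      using codeg_le_deg by (intro add_left_mono mult_right_mono) auto
    also have "\<dots> = r * (?d + ?e)"
      using assms by (simp add: power2_eq_square power3_eq_cube algebra_simps)
    finally have "?lhs \<le> ?d + ?e"
      using assms by simp
    then show ?thesis using terms by linarith
  qed
qed

text \<open>Averages the pointwise bound. \<open>S i\<close> pairs the i-th power of the degree with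
  the square of \<open>F\<close>, and mixing reduces it to degree moments of order at most i +
  1.\<close>

lemma avg_codeg_F_sq_deg:
  assumes "0 < r"
  shows "avg (\<lambda>u. avg (\<lambda>v. codeg u v * (F u v)\<^sup>2 * deg u))
    \<le> 216 * k\<^sup>2 * l\<^sup>2 * p ^ 4 + r * h + 64 * k\<^sup>2 * l\<^sup>2 * p ^ 3 / r"
proof -
  define S where "S i = avg (\<lambda>u. avg (\<lambda>v. deg u ^ i * (F u v)\<^sup>2))" for i
  have S: "S i \<le> l\<^sup>2 * (avg (\<lambda>u. deg u ^ Suc i) + p\<^sup>2 * avg (\<lambda>u. deg u ^ i))" for i
    unfolding S_def by (rule avg_deg_pow_F_sq)
  have "S 1 \<le> l\<^sup>2 * (4 * k\<^sup>2 * p\<^sup>2 + p\<^sup>2 * (2 * k * p))"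
    using S[of 1] deg_moment1 deg_moment2
    by (elim order_trans) (auto intro!: mult_left_mono add_mono simp: numeral_2_eq_2[symmetric])
  also have "\<dots> \<le> l\<^sup>2 * (6 * k\<^sup>2 * p\<^sup>2)"
    using mono_kp[of 2 2 1 2 2 3]
    by (intro mult_left_mono) (simp_all add: power2_eq_square power3_eq_cube algebra_simps)
  finally have S1: "S 1 \<le> l\<^sup>2 * (6 * k\<^sup>2 * p\<^sup>2)" .
  have "S 2 \<le> l\<^sup>2 * (8 * k\<^sup>2 * p ^ 3 + p\<^sup>2 * (4 * k\<^sup>2 * p\<^sup>2))"
    using S[of 2] deg_moment2 deg_moment3
    by (elim order_trans) (auto intro!: mult_left_mono add_mono simp: numeral_3_eq_3[symmetric])
  also have "\<dots> \<le> l\<^sup>2 * (12 * k\<^sup>2 * p ^ 3)"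
    using mono_kp[of 4 4 2 2 3 4]
    by (intro mult_left_mono) (simp_all add: eval_nat_numeral algebra_simps)
  finally have S2: "S 2 \<le> l\<^sup>2 * (12 * k\<^sup>2 * p ^ 3)" .
  have "S 3 \<le> l\<^sup>2 * (8 * k\<^sup>2 * p ^ 3 + p\<^sup>2 * (8 * k\<^sup>2 * p ^ 3))"
    using S[of 3] deg_moment3 deg_moment4
    by (elim order_trans) (auto intro!: mult_left_mono add_mono)
  also have "\<dots> \<le> l\<^sup>2 * (16 * k\<^sup>2 * p ^ 3)"
    using mono_kp[of 8 8 2 2 3 5]
    by (intro mult_left_mono) (simp_all add: eval_nat_numeral algebra_simps)
  finally have S3: "S 3 \<le> l\<^sup>2 * (16 * k\<^sup>2 * p ^ 3)" .
  have S2': "avg (\<lambda>u. avg (\<lambda>v. (deg v)\<^sup>2 * (F u v)\<^sup>2)) = S 2"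
    unfolding S_def by (subst avg_swap) (simp add: F_sym)
  have "avg (\<lambda>u. avg (\<lambda>v. codeg u v * (F u v)\<^sup>2 * deg u))
    \<le> avg (\<lambda>u. avg (\<lambda>v. 8 * p * ((deg u)\<^sup>2 * (F u v)\<^sup>2) + 8 * p * ((deg v)\<^sup>2 * (F u v)\<^sup>2)
      + 4 * p\<^sup>2 * (deg u * (F u v)\<^sup>2) + r * codeg u v ^ 3 + (4 / r) * (deg u ^ 3 * (F u v)\<^sup>2)))"
    using codeg_F_sq_deg_le[OF assms] by (intro avg_mono)
  also have "\<dots> = 8 * p * S 2 + 8 * p * S 2 + 4 * p\<^sup>2 * S 1 + r * h + (4 / r) * S 3"
    unfolding avg_add avg_cmult[of "8 * p"] avg_cmult[of "4 * p\<^sup>2"] avg_cmult[of r] avg_cmult[of "4 / r"] S2'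
    by (simp add: S_def h_def)
  also have "\<dots> \<le> 8 * p * (l\<^sup>2 * (12 * k\<^sup>2 * p ^ 3)) + 8 * p * (l\<^sup>2 * (12 * k\<^sup>2 * p ^ 3))
      + 4 * p\<^sup>2 * (l\<^sup>2 * (6 * k\<^sup>2 * p\<^sup>2)) + r * h + (4 / r) * (l\<^sup>2 * (16 * k\<^sup>2 * p ^ 3))"
    using S1 S2 S3 p_pos assms by (intro add_mono mult_left_mono order_refl) auto
  also have "\<dots> = 216 * k\<^sup>2 * l\<^sup>2 * p ^ 4 + r * h + 64 * k\<^sup>2 * l\<^sup>2 * p ^ 3 / r"
    by (simp add: eval_nat_numeral algebra_simps)
  finally show ?thesis .
qed

lemma avg_codeg_F_sq_P:
  assumes "0 < t"
  shows "p\<^sup>2 * avg (\<lambda>u. avg (\<lambda>v. codeg u v * (F u v)\<^sup>2 * P u))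
    \<le> 687 * k ^ 4 * l\<^sup>2 * p ^ 6 + 2 * t * l\<^sup>2 * h + 128 * k\<^sup>2 * p ^ 9 / t + 3 * l\<^sup>2 * h"
proof -
  \<comment> \<open>This scaling turns the two terms in \<open>r\<close>, once multiplied by 2 p^3,
    into 2 t l^2 h and 128 k^2 p^9 / t, the shape of the main terms in
    \<open>abs_X_le\<close>.\<close>
  define r where "r = t * l\<^sup>2 / p ^ 3"
  have r: "0 < r" using assms l_pos p_pos by (simp add: r_def)
  have "avg (\<lambda>u. avg (\<lambda>v. codeg u v * (F u v)\<^sup>2 * P u))
      \<le> avg (\<lambda>u. avg (\<lambda>v. 2 * p * (codeg u v * (F u v)\<^sup>2 * deg u) + l\<^sup>2 / p * (codeg u v * (F u v)\<^sup>2)))"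
  proof (intro avg_mono)
    fix u v
    have "codeg u v * (F u v)\<^sup>2 * P u \<le> codeg u v * (F u v)\<^sup>2 * (2 * p * deg u + l\<^sup>2 / p)"
      using codeg_nonneg by (intro mult_left_mono P_le) auto
    then show "codeg u v * (F u v)\<^sup>2 * P u
        \<le> 2 * p * (codeg u v * (F u v)\<^sup>2 * deg u) + l\<^sup>2 / p * (codeg u v * (F u v)\<^sup>2)"
      by (simp add: algebra_simps)
  qed
  also have "\<dots> = 2 * p * avg (\<lambda>u. avg (\<lambda>v. codeg u v * (F u v)\<^sup>2 * deg u))
      + l\<^sup>2 / p * avg (\<lambda>u. avg (\<lambda>v. codeg u v * (F u v)\<^sup>2))"
    unfolding avg_add avg_cmult[of "2 * p"] avg_cmult[of "l\<^sup>2 / p"] ..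
  also have "\<dots> \<le> 2 * p * (216 * k\<^sup>2 * l\<^sup>2 * p ^ 4 + r * h + 64 * k\<^sup>2 * l\<^sup>2 * p ^ 3 / r)
      + l\<^sup>2 / p * (3 * h + 255 * k ^ 4 * p ^ 6)"
    using avg_codeg_F_sq_deg[OF r] avg_codeg_F_sq p_pos by (intro add_mono mult_left_mono) auto
  finally have "p\<^sup>2 * avg (\<lambda>u. avg (\<lambda>v. codeg u v * (F u v)\<^sup>2 * P u))
      \<le> p\<^sup>2 * (2 * p * (216 * k\<^sup>2 * l\<^sup>2 * p ^ 4 + r * h + 64 * k\<^sup>2 * l\<^sup>2 * p ^ 3 / r)
      + l\<^sup>2 / p * (3 * h + 255 * k ^ 4 * p ^ 6))"
    by (intro mult_left_mono) auto
  also have "\<dots> = l\<^sup>2 * (432 * k ^ 2 * p ^ 7) + 2 * p ^ 3 * r * h + 128 * k\<^sup>2 * l\<^sup>2 * p ^ 6 / r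
      + l\<^sup>2 * (3 * p * h) + l\<^sup>2 * (255 * k ^ 4 * p ^ 7)"
    using p_pos r by (simp add: eval_nat_numeral field_simps)
  also have "2 * p ^ 3 * r * h = 2 * t * l\<^sup>2 * h"
    using p_pos by (simp add: r_def)
  also have "128 * k\<^sup>2 * l\<^sup>2 * p ^ 6 / r = 128 * k\<^sup>2 * p ^ 9 / t"
    using p_pos l_pos assms by (simp add: r_def field_simps flip: power_add)
  also have "l\<^sup>2 * (432 * k ^ 2 * p ^ 7) + 2 * t * l\<^sup>2 * h + 128 * k\<^sup>2 * p ^ 9 / t
      + l\<^sup>2 * (3 * p * h) + l\<^sup>2 * (255 * k ^ 4 * p ^ 7)
      \<le> l\<^sup>2 * (432 * k ^ 4 * p ^ 6) + 2 * t * l\<^sup>2 * h + 128 * k\<^sup>2 * p ^ 9 / t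
      + l\<^sup>2 * (3 * 1 * h) + l\<^sup>2 * (255 * k ^ 4 * p ^ 6)"
  proof -
    have "l\<^sup>2 * (432 * k ^ 2 * p ^ 7) \<le> l\<^sup>2 * (432 * k ^ 4 * p ^ 6)"
      "l\<^sup>2 * (255 * k ^ 4 * p ^ 7) \<le> l\<^sup>2 * (255 * k ^ 4 * p ^ 6)"
      by (intro mult_left_mono mono_kp; simp)+
    moreover have "l\<^sup>2 * (3 * p * h) \<le> l\<^sup>2 * (3 * 1 * h)"
      using p_le_1 h_nonneg by (intro mult_left_mono mult_right_mono) auto
    ultimately show ?thesis by linarith
  qed
  also have "\<dots> = 687 * k ^ 4 * l\<^sup>2 * p ^ 6 + 2 * t * l\<^sup>2 * h + 128 * k\<^sup>2 * p ^ 9 / t + 3 * l\<^sup>2 * h"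
    by (simp add: algebra_simps)
  finally show ?thesis .
qed

section \<open>Averages over three vertices\<close>

abbreviation avg3 :: "('a \<Rightarrow> 'a \<Rightarrow> 'a \<Rightarrow> real) \<Rightarrow> real" where
  "avg3 f \<equiv> avg (\<lambda>y. avg (\<lambda>u. avg (\<lambda>v. f y u v)))"

text \<open>With \<open>v\<close> outermost, factors in (u, v) and in (v, y) average independently
  of each other.\<close>

lemma avg3_rotate: "avg3 f = avg (\<lambda>v. avg (\<lambda>y. avg (\<lambda>u. f y u v)))"
  by (subst (2) avg_swap) (rule avg_swap)

lemma avg3_codeg_codeg3_sq: "avg3 (\<lambda>y u v. (codeg y u)\<^sup>2 * (codeg3 y u v - p * codeg y u)\<^sup>2) \<le> l\<^sup>2 * h"
proof -
  have "avg3 (\<lambda>y u v. (codeg y u)\<^sup>2 * (codeg3 y u v - p * codeg y u)\<^sup>2)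
      \<le> avg (\<lambda>y. avg (\<lambda>u. l\<^sup>2 * codeg y u ^ 3))"
  proof (intro avg_mono)
    fix y u
    have "(codeg y u)\<^sup>2 * avg (\<lambda>v. (codeg3 y u v - p * codeg y u)\<^sup>2) \<le> (codeg y u)\<^sup>2 * (l\<^sup>2 * codeg y u)"
      by (intro mult_left_mono codeg3_minus_sq) simp
    also have "\<dots> = l\<^sup>2 * codeg y u ^ 3"
      by (simp add: power2_eq_square power3_eq_cube)
    finally show "avg (\<lambda>v. (codeg y u)\<^sup>2 * (codeg3 y u v - p * codeg y u)\<^sup>2) \<le> l\<^sup>2 * codeg y u ^ 3"
      by (simp add: avg_cmult)
  qed
  then show ?thesis by (simp add: avg_cmult h_def)
qed

lemma avg3_codeg_sq: "avg3 (\<lambda>y u v. (codeg u v)\<^sup>2 * (codeg v y)\<^sup>2) \<le> 96 * k ^ 6 * p ^ 7"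
proof -
  have "avg3 (\<lambda>y u v. (codeg u v)\<^sup>2 * (codeg v y)\<^sup>2) = avg (\<lambda>v. (C4 v)\<^sup>2)"
    by (subst avg3_rotate)
      (simp add: avg_multc avg_cmult C4_def codeg_sym power2_eq_square)
  then show ?thesis using avg_C4_sq by simp
qed

text \<open>For fixed \<open>v\<close> each codegree averages to \<open>P v\<close>, which is
  bounded uniformly before the excess is averaged.\<close>

lemma avg3_excess: "avg3 (\<lambda>y u v. codeg u v * codeg v y * (excess v)\<^sup>2) \<le> 9 * k ^ 4 * p\<^sup>2 * l\<^sup>2"
proof -
  have "avg3 (\<lambda>y u v. codeg u v * codeg v y * (excess v)\<^sup>2) = avg (\<lambda>v. (P v)\<^sup>2 * (excess v)\<^sup>2)"
    by (subst avg3_rotate)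
      (simp add: avg_multc avg_cmult P_def codeg_sym power2_eq_square)
  also have "\<dots> \<le> avg (\<lambda>v. (3 * k\<^sup>2 * p)\<^sup>2 * (excess v)\<^sup>2)"
    using P_le_const P_nonneg by (intro avg_mono mult_right_mono power_mono) auto
  also have "\<dots> = (3 * k\<^sup>2 * p)\<^sup>2 * avg (\<lambda>v. (excess v)\<^sup>2)"
    by (rule avg_cmult)
  also have "\<dots> \<le> (3 * k\<^sup>2 * p)\<^sup>2 * l\<^sup>2"
    by (intro mult_left_mono excess_sq) simp
  finally show ?thesis by (simp add: power_mult_distrib flip: power_mult)
qed

text \<open>The vertex absent from \<open>F\<close> occurs in one codegree only and averages out to
  \<open>P v\<close>.\<close>

lemma avg3_F:
  "avg3 (\<lambda>y u v. codeg u v * codeg v y * (F v y)\<^sup>2) = avg (\<lambda>u. avg (\<lambda>v. codeg u v * (F u v)\<^sup>2 * P u))"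
  "avg3 (\<lambda>y u v. codeg u v * codeg v y * (F v u)\<^sup>2) = avg (\<lambda>u. avg (\<lambda>v. codeg u v * (F u v)\<^sup>2 * P u))"
proof -
  have 1: "avg (\<lambda>u. codeg u v * codeg v y * (F v y)\<^sup>2) = codeg v y * (F v y)\<^sup>2 * P v" for v y
    by (simp add: avg_multc P_def codeg_sym[of _ v])
  show "avg3 (\<lambda>y u v. codeg u v * codeg v y * (F v y)\<^sup>2) = avg (\<lambda>u. avg (\<lambda>v. codeg u v * (F u v)\<^sup>2 * P u))"
    by (subst avg3_rotate) (simp add: 1)
  have 2: "avg (\<lambda>y. codeg u v * codeg v y * (F v u)\<^sup>2) = codeg v u * (F v u)\<^sup>2 * P v" for v u
    by (simp add: avg_multc avg_cmult P_def codeg_sym[of u v])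
  show "avg3 (\<lambda>y u v. codeg u v * codeg v y * (F v u)\<^sup>2) = avg (\<lambda>u. avg (\<lambda>v. codeg u v * (F u v)\<^sup>2 * P u))"
    by (subst avg3_rotate, subst (2) avg_swap) (simp add: 2)
qed

text \<open>The first weight does not involve \<open>y\<close>, so \<open>G_sq\<close> applies for
  fixed \<open>u\<close> and \<open>v\<close>; its main term gives the cubed codegree. The second
  average follows by exchanging \<open>y\<close> and \<open>u\<close>.\<close>

lemma avg3_G:
  "avg3 (\<lambda>y u v. (codeg u v)\<^sup>2 * (G y u v)\<^sup>2) \<le> l\<^sup>2 * h + 60 * k ^ 4 * l\<^sup>2 * p ^ 6"
  "avg3 (\<lambda>y u v. (codeg v y)\<^sup>2 * (G y u v)\<^sup>2) = avg3 (\<lambda>y u v. (codeg u v)\<^sup>2 * (G y u v)\<^sup>2)"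
proof -
  have "avg3 (\<lambda>y u v. (codeg u v)\<^sup>2 * (G y u v)\<^sup>2)
      = avg (\<lambda>u. avg (\<lambda>v. (codeg u v)\<^sup>2 * avg (\<lambda>y. (G y u v)\<^sup>2)))"
    by (subst avg_swap, subst (2) avg_swap) (simp add: avg_cmult)
  also have "\<dots> \<le> avg (\<lambda>u. avg (\<lambda>v. l\<^sup>2 * codeg u v ^ 3 + l\<^sup>2 * p\<^sup>2 * ((codeg u v)\<^sup>2 * deg u)
      + l\<^sup>2 * p\<^sup>2 * ((codeg u v)\<^sup>2 * deg v) + l\<^sup>2 * p ^ 4 * (codeg u v)\<^sup>2))"
  proof (intro avg_mono)
    fix u v
    have "(codeg u v)\<^sup>2 * avg (\<lambda>y. (G y u v)\<^sup>2)
        \<le> (codeg u v)\<^sup>2 * (l\<^sup>2 * (codeg u v + p\<^sup>2 * deg u + p\<^sup>2 * deg v + p ^ 4))"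
      by (intro mult_left_mono G_sq) simp
    then show "(codeg u v)\<^sup>2 * avg (\<lambda>y. (G y u v)\<^sup>2)
        \<le> l\<^sup>2 * codeg u v ^ 3 + l\<^sup>2 * p\<^sup>2 * ((codeg u v)\<^sup>2 * deg u)
          + l\<^sup>2 * p\<^sup>2 * ((codeg u v)\<^sup>2 * deg v) + l\<^sup>2 * p ^ 4 * (codeg u v)\<^sup>2"
      by (simp add: eval_nat_numeral algebra_simps)
  qed
  also have "\<dots> = l\<^sup>2 * h + l\<^sup>2 * p\<^sup>2 * avg (\<lambda>v. C4 v * deg v)
      + l\<^sup>2 * p\<^sup>2 * avg (\<lambda>v. C4 v * deg v) + l\<^sup>2 * p ^ 4 * avg C4"
  proof -
    have "avg (\<lambda>v. avg (\<lambda>u. (codeg v u)\<^sup>2 * deg v)) = avg (\<lambda>v. C4 v * deg v)"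
      by (simp add: avg_multc C4_def codeg_sym)
    moreover from this have "avg (\<lambda>u. avg (\<lambda>v. (codeg u v)\<^sup>2 * deg v)) = avg (\<lambda>v. C4 v * deg v)"
      by (subst avg_swap) (simp add: codeg_sym)
    moreover have "avg (\<lambda>u. avg (\<lambda>v. (codeg u v)\<^sup>2)) = avg C4"
      unfolding C4_def by (rule avg_swap)
    ultimately show ?thesis
      unfolding avg_add avg_cmult[of "l\<^sup>2"] avg_cmult[of "l\<^sup>2 * p\<^sup>2"] avg_cmult[of "l\<^sup>2 * p ^ 4"]
      by (simp add: h_def)
  qed
  also have "\<dots> \<le> l\<^sup>2 * h + l\<^sup>2 * p\<^sup>2 * (24 * k ^ 4 * p ^ 5)
      + l\<^sup>2 * p\<^sup>2 * (24 * k ^ 4 * p ^ 5) + l\<^sup>2 * p ^ 4 * (12 * k ^ 3 * p ^ 4)"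
    using avg_C4_deg avg_C4 by (intro add_mono mult_left_mono) auto
  also have "\<dots> = l\<^sup>2 * h + l\<^sup>2 * (48 * k ^ 4 * p ^ 7) + l\<^sup>2 * (12 * k ^ 3 * p ^ 8)"
    by (simp add: eval_nat_numeral algebra_simps)
  also have "\<dots> \<le> l\<^sup>2 * h + l\<^sup>2 * (48 * k ^ 4 * p ^ 6) + l\<^sup>2 * (12 * k ^ 4 * p ^ 6)"
    by (intro add_mono mult_left_mono mono_kp) auto
  finally show "avg3 (\<lambda>y u v. (codeg u v)\<^sup>2 * (G y u v)\<^sup>2) \<le> l\<^sup>2 * h + 60 * k ^ 4 * l\<^sup>2 * p ^ 6"
    by (simp add: algebra_simps)
  show "avg3 (\<lambda>y u v. (codeg v y)\<^sup>2 * (G y u v)\<^sup>2) = avg3 (\<lambda>y u v. (codeg u v)\<^sup>2 * (G y u v)\<^sup>2)"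
    by (subst avg_swap) (simp add: G_sym codeg_sym)
qed

section \<open>The normalised deviation and its bounds\<close>

text \<open>In the graph case this is (H3_plus - p H3) / |W|^7.\<close>

definition X :: real where
  "X = avg3 (\<lambda>y u v. codeg u v * codeg v y * codeg3 y u v * (codeg3 y u v - p * codeg y u))"

text \<open>With D = codeg3 - p codeg, one factor \<open>codeg3\<close> is bounded by |D| + p codeg.
  The linear term is split by AM-GM, and in the quadratic one D is expanded by
  \<open>codeg3_minus_expand\<close>.\<close>

lemma X_summand_le:
  assumes "0 < t"
  shows "\<bar>codeg u v * codeg v y * codeg3 y u v * (codeg3 y u v - p * codeg y u)\<bar>
    \<le> t * ((codeg y u)\<^sup>2 * (codeg3 y u v - p * codeg y u)\<^sup>2) + p\<^sup>2 / t * ((codeg u v)\<^sup>2 * (codeg v y)\<^sup>2)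
      + 4 * p ^ 4 * (codeg u v * codeg v y * (excess v)\<^sup>2)
      + 4 * p\<^sup>2 * (codeg u v * codeg v y * (F v y)\<^sup>2) + 4 * p\<^sup>2 * (codeg u v * codeg v y * (F v u)\<^sup>2)
      + 2 * ((codeg u v)\<^sup>2 * (G y u v)\<^sup>2) + 2 * ((codeg v y)\<^sup>2 * (G y u v)\<^sup>2)"
proof -
  define w D c where wDc: "w = codeg u v * codeg v y" "D = codeg3 y u v - p * codeg y u" "c = codeg y u"
  have w: "0 \<le> w" and c: "0 \<le> c" using codeg_nonneg by (auto simp: wDc)
  have "\<bar>w * codeg3 y u v * D\<bar> = w * \<bar>D\<bar> * codeg3 y u v"
    using w codeg3_nonneg by (simp add: abs_mult)
  also have "\<dots> \<le> w * \<bar>D\<bar> * (\<bar>D\<bar> + p * c)"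
    using w by (intro mult_left_mono) (auto simp: wDc)
  also have "\<dots> = w * D\<^sup>2 + (c * \<bar>D\<bar>) * (p * w)"
    by (simp add: algebra_simps power2_eq_square flip: abs_mult)
  \<comment> \<open>The weight \<open>t\<close> stays free until \<open>abs_X_bound\<close>
    optimises it.\<close>
  also have "(c * \<bar>D\<bar>) * (p * w) \<le> t * (c * \<bar>D\<bar>)\<^sup>2 + (p * w)\<^sup>2 / t"
  proof -
    have "0 \<le> (t * (c * \<bar>D\<bar>) - p * w)\<^sup>2 + (t * (c * \<bar>D\<bar>)) * (p * w)"
      using assms c w p_pos by (intro add_nonneg_nonneg mult_nonneg_nonneg) auto
    then show ?thesis
      using assms by (simp add: field_simps power2_eq_square)
  qed
  also have "w * D\<^sup>2 \<le> w * (4 * (p\<^sup>2 * excess v)\<^sup>2 + 4 * (p * F v y)\<^sup>2 + 4 * (p * F v u)\<^sup>2 + 4 * (G y u v)\<^sup>2)"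
  proof (rule mult_left_mono[OF _ w])
    have D: "D = p\<^sup>2 * excess v + p * F v y + p * F v u + G y u v"
      using codeg3_minus_expand by (simp add: wDc)
    have four: "(a + b + c + d)\<^sup>2 \<le> 4 * a\<^sup>2 + 4 * b\<^sup>2 + 4 * c\<^sup>2 + 4 * d\<^sup>2" for a b c d :: real
    proof -
      have "0 \<le> (a - b)\<^sup>2 + (a - c)\<^sup>2 + (a - d)\<^sup>2 + (b - c)\<^sup>2 + (b - d)\<^sup>2 + (c - d)\<^sup>2"
        by (intro add_nonneg_nonneg zero_le_power2)
      then show ?thesis by (simp add: power2_eq_square algebra_simps)
    qed
    show "D\<^sup>2 \<le> 4 * (p\<^sup>2 * excess v)\<^sup>2 + 4 * (p * F v y)\<^sup>2 + 4 * (p * F v u)\<^sup>2 + 4 * (G y u v)\<^sup>2"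
      unfolding D by (rule four)
  qed
  also have "\<dots> \<le> 4 * p ^ 4 * (w * (excess v)\<^sup>2) + 4 * p\<^sup>2 * (w * (F v y)\<^sup>2) + 4 * p\<^sup>2 * (w * (F v u)\<^sup>2)
      + 2 * ((codeg u v)\<^sup>2 * (G y u v)\<^sup>2) + 2 * ((codeg v y)\<^sup>2 * (G y u v)\<^sup>2)"
  proof -
    \<comment> \<open>Squares replace the product of two codegrees, so that each term leaves one
      vertex free for mixing on \<open>G\<close>.\<close>
    have "4 * w \<le> 2 * (codeg u v)\<^sup>2 + 2 * (codeg v y)\<^sup>2"
      using zero_le_power2[of "codeg u v - codeg v y"] by (simp add: wDc power2_diff)
    then have "4 * w * (G y u v)\<^sup>2 \<le> (2 * (codeg u v)\<^sup>2 + 2 * (codeg v y)\<^sup>2) * (G y u v)\<^sup>2"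
      by (intro mult_right_mono) auto
    then show ?thesis
      by (simp add: power_mult_distrib algebra_simps flip: power_mult)
  qed
  finally show ?thesis
    by (simp add: wDc power_mult_distrib mult.assoc)
qed

lemma abs_X_le_avg3: "\<bar>X\<bar> \<le> avg3 (\<lambda>y u v. \<bar>codeg u v * codeg v y * codeg3 y u v * (codeg3 y u v - p * codeg y u)\<bar>)"
  unfolding X_def by (intro order_trans[OF avg_abs] avg_mono order_refl)

text \<open>The constants collect as 17 = 1 + 8 * 2, 1120 = 96 + 8 * 128, 5772 = 36 + 8 * 687 + 4 *
  60 and 28 = 8 * 3 + 4.\<close>

lemma abs_X_le:
  assumes "0 < t"
  shows "\<bar>X\<bar> \<le> 17 * t * l\<^sup>2 * h + 1120 * k ^ 6 * p ^ 9 / t + 5772 * k ^ 4 * p ^ 6 * l\<^sup>2 + 28 * l\<^sup>2 * h"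
proof -
  define Y where "Y = avg (\<lambda>u. avg (\<lambda>v. codeg u v * (F u v)\<^sup>2 * P u))"
  define Z where "Z = avg3 (\<lambda>y u v. (codeg u v)\<^sup>2 * (G y u v)\<^sup>2)"
  have "\<bar>X\<bar> \<le> avg3 (\<lambda>y u v. t * ((codeg y u)\<^sup>2 * (codeg3 y u v - p * codeg y u)\<^sup>2)
      + p\<^sup>2 / t * ((codeg u v)\<^sup>2 * (codeg v y)\<^sup>2)
      + 4 * p ^ 4 * (codeg u v * codeg v y * (excess v)\<^sup>2)
      + 4 * p\<^sup>2 * (codeg u v * codeg v y * (F v y)\<^sup>2) + 4 * p\<^sup>2 * (codeg u v * codeg v y * (F v u)\<^sup>2)
      + 2 * ((codeg u v)\<^sup>2 * (G y u v)\<^sup>2) + 2 * ((codeg v y)\<^sup>2 * (G y u v)\<^sup>2))"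
    by (rule order_trans[OF abs_X_le_avg3]) (intro avg_mono X_summand_le assms)
  also have "\<dots> = t * avg3 (\<lambda>y u v. (codeg y u)\<^sup>2 * (codeg3 y u v - p * codeg y u)\<^sup>2)
      + p\<^sup>2 / t * avg3 (\<lambda>y u v. (codeg u v)\<^sup>2 * (codeg v y)\<^sup>2)
      + 4 * p ^ 4 * avg3 (\<lambda>y u v. codeg u v * codeg v y * (excess v)\<^sup>2)
      + 4 * p\<^sup>2 * Y + 4 * p\<^sup>2 * Y + 2 * Z + 2 * Z"
    unfolding avg_add avg_cmult[of t] avg_cmult[of "p\<^sup>2 / t"] avg_cmult[of "4 * p ^ 4"]
      avg_cmult[of "4 * p\<^sup>2"] avg_cmult[of 2] avg3_F avg3_G(2) Y_def Z_def ..
  also have "\<dots> \<le> t * (l\<^sup>2 * h) + p\<^sup>2 / t * (96 * k ^ 6 * p ^ 7) + 4 * p ^ 4 * (9 * k ^ 4 * p\<^sup>2 * l\<^sup>2)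
      + 4 * p\<^sup>2 * Y + 4 * p\<^sup>2 * Y + 2 * Z + 2 * Z"
    using assms p_pos avg3_codeg_codeg3_sq avg3_codeg_sq avg3_excess
    by (intro add_mono mult_left_mono order_refl) auto
  also have "\<dots> = t * l\<^sup>2 * h + 96 * k ^ 6 * p ^ 9 / t + 36 * (k ^ 4 * p ^ 6 * l\<^sup>2) + 8 * (p\<^sup>2 * Y) + 4 * Z"
    by (simp add: eval_nat_numeral algebra_simps)
  also have "\<dots> \<le> t * l\<^sup>2 * h + 96 * k ^ 6 * p ^ 9 / t + 36 * (k ^ 4 * p ^ 6 * l\<^sup>2)
      + 8 * (687 * k ^ 4 * l\<^sup>2 * p ^ 6 + 2 * t * l\<^sup>2 * h + 128 * k\<^sup>2 * p ^ 9 / t + 3 * l\<^sup>2 * h)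
      + 4 * (l\<^sup>2 * h + 60 * k ^ 4 * l\<^sup>2 * p ^ 6)"
    using avg_codeg_F_sq_P[OF assms] avg3_G(1) unfolding Y_def Z_def
    by (intro add_mono mult_left_mono order_refl) auto
  also have "\<dots> = 17 * t * l\<^sup>2 * h + (96 * k ^ 6 * p ^ 9 + 1024 * k ^ 2 * p ^ 9) / t
      + 5772 * k ^ 4 * p ^ 6 * l\<^sup>2 + 28 * l\<^sup>2 * h"
    by (simp add: algebra_simps add_divide_distrib)
  also have "\<dots> \<le> 17 * t * l\<^sup>2 * h + 1120 * k ^ 6 * p ^ 9 / t + 5772 * k ^ 4 * p ^ 6 * l\<^sup>2 + 28 * l\<^sup>2 * h"
    using assms mono_kp[of 1024 1024 2 6 9 9]
    by (intro add_mono divide_right_mono order_refl) auto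
  finally show ?thesis .
qed

text \<open>The assumption keeps the mean degree at least p / 2. Jensen's inequality is then used
  twice through tangent lines: of the square at p / 2, and of the cube at a = p^2 / 4.\<close>

lemma h_ge:
  assumes "l \<le> p / 2"
  shows "p ^ 6 / 64 \<le> h"
proof -
  define a where "a = p\<^sup>2 / 4"
  have "p / 2 \<le> avg deg"
    using assms abs_avg_excess by (simp add: avg_deg)
  then have "p * (p / 2) - a \<le> p * avg deg - a"
    using p_pos by (intro diff_right_mono mult_left_mono) auto
  also have "\<dots> = avg (\<lambda>x. p * deg x - a)"
    by (simp add: avg_linear)
  also have "\<dots> \<le> avg (\<lambda>x. deg x * deg x)"
  proof (rule avg_mono)
    fix x
    have "0 \<le> (deg x - p / 2)\<^sup>2" by simp
    then show "p * deg x - a \<le> deg x * deg x"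
      by (simp add: a_def power2_eq_square algebra_simps)
  qed
  also have "\<dots> = avg (\<lambda>x. avg (\<lambda>u. avg (\<lambda>v. A u x * A x v)))"
    by (simp add: avg_cmult avg_multc avg_A_col) (simp add: deg_def)
  also have "\<dots> = avg (\<lambda>u. avg (codeg u))"
    unfolding codeg_def by (subst avg_swap, subst (2) avg_swap) simp
  finally have "a \<le> avg (\<lambda>u. avg (codeg u))"
    by (simp add: a_def power2_eq_square)
  then have "3 * a\<^sup>2 * a - 2 * a ^ 3 \<le> 3 * a\<^sup>2 * avg (\<lambda>u. avg (codeg u)) - 2 * a ^ 3"
    by (intro diff_right_mono mult_left_mono) auto
  also have "\<dots> = avg (\<lambda>u. avg (\<lambda>v. 3 * a\<^sup>2 * codeg u v - 2 * a ^ 3))"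
    by (simp add: avg_linear)
  also have "\<dots> \<le> h"
    unfolding h_def
  proof (intro avg_mono)
    fix u v
    have "0 \<le> (codeg u v - a)\<^sup>2 * (codeg u v + 2 * a)"
      using codeg_nonneg by (intro mult_nonneg_nonneg) (auto simp: a_def)
    then show "3 * a\<^sup>2 * codeg u v - 2 * a ^ 3 \<le> codeg u v ^ 3"
      by (simp add: power2_eq_square power3_eq_cube algebra_simps)
  qed
  finally show ?thesis
    by (simp add: a_def eval_nat_numeral)
qed

text \<open>Trivial bounds make each summand at most c^2 with c = codeg y u, and c^2 \<le> t c^3 + 1
  / t. This serves the range l > p / 2.\<close>

lemma abs_X_le_sqrt_h: "\<bar>X\<bar> \<le> 2 * sqrt h"
proof -
  have "\<bar>X\<bar> \<le> t * h + 1 / t" if t: "0 < t" for t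
  proof -
    have "\<bar>X\<bar> \<le> avg (\<lambda>y. avg (\<lambda>u. avg (\<lambda>v. t * codeg y u ^ 3 + 1 / t)))"
    proof (rule order_trans[OF abs_X_le_avg3], intro avg_mono)
      fix y u v
      define c where "c = codeg y u"
      have c: "0 \<le> c" "c \<le> 1" using codeg_nonneg codeg_le_1 by (auto simp: c_def)
      have "codeg u v * codeg v y \<le> 1 * 1"
        using codeg_nonneg codeg_le_1 by (intro mult_mono) auto
      moreover have "\<bar>codeg3 y u v - p * c\<bar> \<le> c"
      proof -
        have "0 \<le> p * c" "p * c \<le> c" using c p_pos p_le_1 by (auto simp: mult_left_le_one_le)
        then show ?thesis using codeg3_nonneg[of y u v] codeg3_le_codeg[of y u v] by (auto simp: c_def)
      qed
      ultimately have "(codeg u v * codeg v y) * codeg3 y u v * \<bar>codeg3 y u v - p * c\<bar> \<le> 1 * c * c"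
        using codeg3_nonneg codeg3_le_codeg codeg_nonneg c unfolding c_def by (intro mult_mono) auto
      also have "\<dots> \<le> t * c ^ 3 + 1 / t"
      proof -
        have "0 \<le> c * (t * c - 1)\<^sup>2 + (1 - c) + t * c\<^sup>2"
          using c t by (intro add_nonneg_nonneg mult_nonneg_nonneg) auto
        then show ?thesis
          using t by (simp add: field_simps power2_eq_square power3_eq_cube)
      qed
      finally show "\<bar>codeg u v * codeg v y * codeg3 y u v * (codeg3 y u v - p * codeg y u)\<bar> \<le> t * codeg y u ^ 3 + 1 / t"
        using codeg_nonneg codeg3_nonneg by (simp add: abs_mult c_def)
    qed
    also have "\<dots> = t * h + 1 / t"
      unfolding avg_add avg_const avg_cmult[of t] h_def ..
    finally show ?thesis .
  qed
  from le_sqrt_if_le_all_weights[OF this _ zero_le_one] show ?thesis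
    using h_nonneg by simp
qed

text \<open>If l \<le> p / 2, the weight in \<open>abs_X_le\<close> is optimised, and the terms free
  of \<open>t\<close> are absorbed by \<open>h_ge\<close> and l \<le> k p^(3/2). Otherwise p / 2 < l
  \<le> k p^(3/2) bounds p from below, and the crude bound \<open>abs_X_le_sqrt_h\<close> is
  enough.\<close>

lemma abs_X_bound: "\<bar>X\<bar> \<le> 50000 * k ^ 11 * (l * sqrt (h * p) * sqrt (p ^ 8 + l * h))"
proof -
  \<comment> \<open>\<open>T0\<close> is \<open>T\<close> with \<open>l * h\<close> dropped under
    the last root.\<close>
  define T T0 where "T = l * sqrt (h * p) * sqrt (p ^ 8 + l * h)" and "T0 = l * sqrt (h * p) * p ^ 4"
  have nn: "0 \<le> h" "0 < p" "0 < l" "1 \<le> k" "0 < k"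
    using h_nonneg p_pos l_pos k_ge_1 by auto
  have "sqrt (p ^ 8) = p ^ 4"
    using nn by (intro real_sqrt_unique) (simp_all flip: power_mult)
  then have "p ^ 4 \<le> sqrt (p ^ 8 + l * h)"
    using nn by (metis add_increasing2 mult_nonneg_nonneg less_imp_le order_refl real_sqrt_le_iff)
  then have T0: "T0 \<le> T"
    unfolding T0_def T_def using nn by (intro mult_left_mono) auto
  have T0_nn: "0 \<le> T0" unfolding T0_def using nn by simp
  have l_le: "l \<le> k * (p * sqrt p)"
  proof (rule power2_le_imp_le)
    have "(k * (p * sqrt p))\<^sup>2 = k\<^sup>2 * p ^ 3"
      using nn by (simp add: power_mult_distrib) (simp add: eval_nat_numeral)
    then show "l\<^sup>2 \<le> (k * (p * sqrt p))\<^sup>2"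
      using l_sq_le by simp
  qed (use nn in auto)
  show ?thesis
  proof (cases "l \<le> p / 2")
    case True
    define R where "R = 5772 * k ^ 4 * p ^ 6 * l\<^sup>2 + 28 * l\<^sup>2 * h"
    have "\<bar>X\<bar> - R \<le> 2 * sqrt ((17 * l\<^sup>2 * h) * (1120 * k ^ 6 * p ^ 9))"
    proof (rule le_sqrt_if_le_all_weights)
      show "\<bar>X\<bar> - R \<le> t * (17 * l\<^sup>2 * h) + 1120 * k ^ 6 * p ^ 9 / t" if "0 < t" for t
        using abs_X_le[OF that] by (simp add: R_def algebra_simps)
    qed (use nn in auto)
    \<comment> \<open>138^2 = 19044 just exceeds 17 * 1120 = 19040.\<close>
    also have "sqrt ((17 * l\<^sup>2 * h) * (1120 * k ^ 6 * p ^ 9)) \<le> 138 * k ^ 3 * T0"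
    proof (rule real_le_lsqrt)
      have "(138 * k ^ 3 * T0)\<^sup>2 = 19044 * (k ^ 6 * l\<^sup>2 * h * p ^ 9)"
        using nn by (simp add: T0_def power_mult_distrib eval_nat_numeral)
      moreover have "0 \<le> k ^ 6 * l\<^sup>2 * h * p ^ 9" using nn by simp
      ultimately show "(17 * l\<^sup>2 * h) * (1120 * k ^ 6 * p ^ 9) \<le> (138 * k ^ 3 * T0)\<^sup>2"
        by (simp add: mult.assoc mult.left_commute mult.commute)
    qed (use nn T0_nn in auto)
    finally have 1: "\<bar>X\<bar> - R \<le> 276 * k ^ 3 * T0" by simp
    have "p ^ 3 \<le> 8 * sqrt h"
    proof (rule power2_le_imp_le)
      show "(p ^ 3)\<^sup>2 \<le> (8 * sqrt h)\<^sup>2"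
        using h_ge[OF True] nn by (simp add: power_mult_distrib flip: power_mult)
    qed (use nn in auto)
    then have "l * p ^ 4 * k * sqrt p * p ^ 3 \<le> l * p ^ 4 * k * sqrt p * (8 * sqrt h)"
      using nn by (intro mult_left_mono) auto
    moreover have "p ^ 6 * l * l \<le> p ^ 6 * l * (k * (p * sqrt p))"
      using nn l_le by (intro mult_left_mono) auto
    \<comment> \<open>One factor l is traded for k p^(3/2), and a factor p^3 for 8 sqrt h.\<close>
    ultimately have 2: "p ^ 6 * l\<^sup>2 \<le> 8 * k * T0"
      by (simp add: T0_def real_sqrt_mult power2_eq_square eval_nat_numeral algebra_simps)
    \<comment> \<open>From l \<le> k p \<le> k^2 p. In l^2 h one factor sqrt l is then traded for k
      sqrt p, and another goes into sqrt (l h), which is at most the last root in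
      \<open>T\<close>.\<close>
    have "sqrt l \<le> k * sqrt p"
    proof (rule real_le_lsqrt)
      have "(k * sqrt p)\<^sup>2 = k * (k * p)"
        using nn by (simp add: power_mult_distrib) (simp add: power2_eq_square)
      moreover have "1 * (k * p) \<le> k * (k * p)"
        using nn by (intro mult_right_mono) auto
      ultimately show "l \<le> (k * sqrt p)\<^sup>2"
        using l_le_p by simp
    qed (use nn in auto)
    then have "l * h * sqrt l * sqrt l \<le> l * h * sqrt l * (k * sqrt p)"
      using nn by (intro mult_left_mono) auto
    also have "\<dots> = k * (l * sqrt (h * p) * sqrt (l * h))"
      using nn by (simp add: real_sqrt_mult)
    also have "\<dots> \<le> k * T"
      unfolding T_def using nn by (intro mult_left_mono) auto
    also have "l * h * sqrt l * sqrt l = l\<^sup>2 * h"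
      using nn by (simp add: power2_eq_square)
    finally have 3: "l\<^sup>2 * h \<le> k * T" .
    have "R \<le> 5772 * k ^ 4 * (8 * k * T0) + 28 * (k * T)"
    proof -
      have "5772 * k ^ 4 * (p ^ 6 * l\<^sup>2) \<le> 5772 * k ^ 4 * (8 * k * T0)"
        using 2 nn by (intro mult_left_mono) auto
      moreover have "R = 5772 * k ^ 4 * (p ^ 6 * l\<^sup>2) + 28 * (l\<^sup>2 * h)"
        by (simp add: R_def)
      ultimately show ?thesis using 3 by linarith
    qed
    then have "\<bar>X\<bar> \<le> 276 * k ^ 3 * T0 + 46176 * k ^ 5 * T0 + 28 * k ^ 1 * T"
      using 1 by (simp add: eval_nat_numeral)
    also have "\<dots> \<le> 276 * k ^ 11 * T + 46176 * k ^ 11 * T + 28 * k ^ 11 * T"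
      using T0 T0_nn nn by (intro add_mono mult_mono k_pow_le order_refl) auto
    also have "\<dots> \<le> 50000 * k ^ 11 * T"
      using T0 T0_nn nn by simp
    finally show ?thesis by (simp add: T_def)
  next
    case False
    have "p * 1 \<le> p * (2 * k * sqrt p)"
      using False l_le by (simp add: algebra_simps)
    then have "1 \<le> 2 * k * sqrt p"
      using nn by (simp add: mult_le_cancel_left_pos)
    then have "1 \<le> (2 * k * sqrt p) ^ 11"
      by (rule one_le_power)
    \<comment> \<open>The exponent 11 is forced: (sqrt p)^11 = p^5 sqrt p is the power of p in p / 2
      * sqrt (h p) * p^4.\<close>
    then have "2 * sqrt h * 1 \<le> 2 * sqrt h * (2 * k * sqrt p) ^ 11"
      using nn by (intro mult_left_mono) auto
    also have "\<dots> = 8192 * k ^ 11 * (p / 2 * sqrt (h * p) * p ^ 4)"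
      using nn by (simp add: real_sqrt_mult power_mult_distrib eval_nat_numeral)
    also have "\<dots> \<le> 8192 * k ^ 11 * T0"
      unfolding T0_def using nn False by (intro mult_left_mono mult_right_mono) auto
    also have "\<dots> \<le> 50000 * k ^ 11 * T"
      using T0 T0_nn nn by (intro mult_mono) auto
    finally show ?thesis
      using abs_X_le_sqrt_h unfolding T_def by linarith
  qed
qed

end

section \<open>Counting configurations\<close>

lemma card_filter_eq_sum: "finite S \<Longrightarrow> real (card {t \<in> S. Q t}) = (\<Sum>t\<in>S. of_bool (Q t))"
  by (simp add: sum_of_bool_eq Int_def)

context
  fixes G :: "('a, 'b) pre_digraph" and W :: "'a set"
  assumes G: "graph G" and W: "finite W"
begin

private abbreviation (input) a :: "'a \<Rightarrow> 'a \<Rightarrow> real" where "a x y \<equiv> of_bool (x \<rightarrow>\<^bsub>G\<^esub> y)"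

lemma dominates_sym: "x \<rightarrow>\<^bsub>G\<^esub> y \<longleftrightarrow> y \<rightarrow>\<^bsub>G\<^esub> x"
proof -
  interpret graph G by (rule G)
  show ?thesis using arcs_ends_symmetric[OF sym_arcs] by blast
qed

text \<open>For fixed \<open>u\<close> and \<open>y\<close>, the vertices \<open>x\<close>,
  \<open>z\<close>, \<open>v\<close> range independently over common neighbours.\<close>

lemma H2_eq_sum: "real (H2 G W) = (\<Sum>u\<in>W. \<Sum>y\<in>W. (\<Sum>x\<in>W. a u x * a x y) ^ 3)"
proof -
  have "{(x, y, z, u, v). {x, y, z, u, v} \<subseteq> W \<and>
     x \<rightarrow>\<^bsub>G\<^esub> u \<and> u \<rightarrow>\<^bsub>G\<^esub> z \<and> z \<rightarrow>\<^bsub>G\<^esub> y \<and> x \<rightarrow>\<^bsub>G\<^esub> y \<and> u \<rightarrow>\<^bsub>G\<^esub> v \<and> v \<rightarrow>\<^bsub>G\<^esub> y}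
    = {t \<in> W \<times> W \<times> W \<times> W \<times> W. case t of (x, y, z, u, v) \<Rightarrow>
     x \<rightarrow>\<^bsub>G\<^esub> u \<and> u \<rightarrow>\<^bsub>G\<^esub> z \<and> z \<rightarrow>\<^bsub>G\<^esub> y \<and> x \<rightarrow>\<^bsub>G\<^esub> y \<and> u \<rightarrow>\<^bsub>G\<^esub> v \<and> v \<rightarrow>\<^bsub>G\<^esub> y}"
    by auto
  then have "real (H2 G W) = (\<Sum>t\<in>W \<times> W \<times> W \<times> W \<times> W. of_bool (case t of (x, y, z, u, v) \<Rightarrow>
     x \<rightarrow>\<^bsub>G\<^esub> u \<and> u \<rightarrow>\<^bsub>G\<^esub> z \<and> z \<rightarrow>\<^bsub>G\<^esub> y \<and> x \<rightarrow>\<^bsub>G\<^esub> y \<and> u \<rightarrow>\<^bsub>G\<^esub> v \<and> v \<rightarrow>\<^bsub>G\<^esub> y))"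
    unfolding H2_def using W by (simp only:) (rule card_filter_eq_sum, simp)
  also have "\<dots> = (\<Sum>(u, y, x, z, v)\<in>W \<times> W \<times> W \<times> W \<times> W.
      (a u x * a x y) * ((a u z * a z y) * (a u v * a v y)))"
    by (rule sum.reindex_bij_witness[where i = "\<lambda>(u, y, x, z, v). (x, y, z, u, v)"
          and j = "\<lambda>(x, y, z, u, v). (u, y, x, z, v)"])
      (auto simp: of_bool_conj dominates_sym mult_ac)
  also have "\<dots> = (\<Sum>u\<in>W. \<Sum>y\<in>W. \<Sum>x\<in>W. \<Sum>z\<in>W. \<Sum>v\<in>W.
      (a u x * a x y) * ((a u z * a z y) * (a u v * a v y)))"
    by (simp only: sum.cartesian_product)
  also have "\<dots> = (\<Sum>u\<in>W. \<Sum>y\<in>W. (\<Sum>x\<in>W. a u x * a x y) *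
      ((\<Sum>z\<in>W. a u z * a z y) * (\<Sum>v\<in>W. a u v * a v y)))"
    by (simp only: sum_distrib_left[symmetric] sum_distrib_right[symmetric])
  finally show ?thesis by (simp add: power3_eq_cube mult.assoc)
qed

text \<open>For fixed y, u, u' the other four vertices are independent: x is joined to y and u, z to
  all three, v to u and u', x' to u' and y. The summation variable \<open>v\<close> stands for
  u'.\<close>

lemma H3_eq_sum: "real (H3 G W) = (\<Sum>y\<in>W. \<Sum>u\<in>W. \<Sum>v\<in>W. (\<Sum>x\<in>W. a y x * a x u) *
    ((\<Sum>z\<in>W. a y z * a u z * a v z) * ((\<Sum>x\<in>W. a u x * a x v) * (\<Sum>x\<in>W. a v x * a x y))))"
proof -
  have "{(x, y, z, u, v, u', x'). {x, y, z, u, v, u', x'} \<subseteq> W \<and>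
     x \<rightarrow>\<^bsub>G\<^esub> y \<and> y \<rightarrow>\<^bsub>G\<^esub> z \<and> z \<rightarrow>\<^bsub>G\<^esub> u \<and> u \<rightarrow>\<^bsub>G\<^esub> x \<and> u \<rightarrow>\<^bsub>G\<^esub> v \<and> v \<rightarrow>\<^bsub>G\<^esub> u' \<and>
     u' \<rightarrow>\<^bsub>G\<^esub> z \<and> u' \<rightarrow>\<^bsub>G\<^esub> x' \<and> x' \<rightarrow>\<^bsub>G\<^esub> y}
    = {t \<in> W \<times> W \<times> W \<times> W \<times> W \<times> W \<times> W. case t of (x, y, z, u, v, u', x') \<Rightarrow>
     x \<rightarrow>\<^bsub>G\<^esub> y \<and> y \<rightarrow>\<^bsub>G\<^esub> z \<and> z \<rightarrow>\<^bsub>G\<^esub> u \<and> u \<rightarrow>\<^bsub>G\<^esub> x \<and> u \<rightarrow>\<^bsub>G\<^esub> v \<and> v \<rightarrow>\<^bsub>G\<^esub> u' \<and>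
     u' \<rightarrow>\<^bsub>G\<^esub> z \<and> u' \<rightarrow>\<^bsub>G\<^esub> x' \<and> x' \<rightarrow>\<^bsub>G\<^esub> y}"
    by auto
  then have "real (H3 G W) = (\<Sum>t\<in>W \<times> W \<times> W \<times> W \<times> W \<times> W \<times> W.
     of_bool (case t of (x, y, z, u, v, u', x') \<Rightarrow>
     x \<rightarrow>\<^bsub>G\<^esub> y \<and> y \<rightarrow>\<^bsub>G\<^esub> z \<and> z \<rightarrow>\<^bsub>G\<^esub> u \<and> u \<rightarrow>\<^bsub>G\<^esub> x \<and> u \<rightarrow>\<^bsub>G\<^esub> v \<and> v \<rightarrow>\<^bsub>G\<^esub> u' \<and>
     u' \<rightarrow>\<^bsub>G\<^esub> z \<and> u' \<rightarrow>\<^bsub>G\<^esub> x' \<and> x' \<rightarrow>\<^bsub>G\<^esub> y))"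
    unfolding H3_def using W by (simp only:) (rule card_filter_eq_sum, simp)
  also have "\<dots> = (\<Sum>(y, u, u', x, z, v, x')\<in>W \<times> W \<times> W \<times> W \<times> W \<times> W \<times> W.
      (a y x * a x u) * ((a y z * a u z * a u' z) * ((a u v * a v u') * (a u' x' * a x' y))))"
    by (rule sum.reindex_bij_witness[where i = "\<lambda>(y, u, u', x, z, v, x'). (x, y, z, u, v, u', x')"
          and j = "\<lambda>(x, y, z, u, v, u', x'). (y, u, u', x, z, v, x')"])
      (auto simp: of_bool_conj dominates_sym mult_ac)
  also have "\<dots> = (\<Sum>y\<in>W. \<Sum>u\<in>W. \<Sum>u'\<in>W. \<Sum>x\<in>W. \<Sum>z\<in>W. \<Sum>v\<in>W. \<Sum>x'\<in>W.
      (a y x * a x u) * ((a y z * a u z * a u' z) * ((a u v * a v u') * (a u' x' * a x' y))))"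
    by (simp only: sum.cartesian_product)
  finally show ?thesis
    by (simp only: sum_distrib_left[symmetric] sum_distrib_right[symmetric])
qed

text \<open>The extra edge from x to u' makes x, like z, a common neighbour of all three fixed
  vertices.\<close>

lemma H3_plus_eq_sum: "real (H3_plus G W) = (\<Sum>y\<in>W. \<Sum>u\<in>W. \<Sum>v\<in>W. (\<Sum>z\<in>W. a y z * a u z * a v z) *
    ((\<Sum>z\<in>W. a y z * a u z * a v z) * ((\<Sum>x\<in>W. a u x * a x v) * (\<Sum>x\<in>W. a v x * a x y))))"
proof -
  have "{(x, y, z, u, v, u', x'). {x, y, z, u, v, u', x'} \<subseteq> W \<and>
     x \<rightarrow>\<^bsub>G\<^esub> y \<and> y \<rightarrow>\<^bsub>G\<^esub> z \<and> z \<rightarrow>\<^bsub>G\<^esub> u \<and> u \<rightarrow>\<^bsub>G\<^esub> x \<and> u \<rightarrow>\<^bsub>G\<^esub> v \<and> v \<rightarrow>\<^bsub>G\<^esub> u' \<and>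
     u' \<rightarrow>\<^bsub>G\<^esub> z \<and> u' \<rightarrow>\<^bsub>G\<^esub> x' \<and> x' \<rightarrow>\<^bsub>G\<^esub> y \<and> x \<rightarrow>\<^bsub>G\<^esub> u'}
    = {t \<in> W \<times> W \<times> W \<times> W \<times> W \<times> W \<times> W. case t of (x, y, z, u, v, u', x') \<Rightarrow>
     x \<rightarrow>\<^bsub>G\<^esub> y \<and> y \<rightarrow>\<^bsub>G\<^esub> z \<and> z \<rightarrow>\<^bsub>G\<^esub> u \<and> u \<rightarrow>\<^bsub>G\<^esub> x \<and> u \<rightarrow>\<^bsub>G\<^esub> v \<and> v \<rightarrow>\<^bsub>G\<^esub> u' \<and>
     u' \<rightarrow>\<^bsub>G\<^esub> z \<and> u' \<rightarrow>\<^bsub>G\<^esub> x' \<and> x' \<rightarrow>\<^bsub>G\<^esub> y \<and> x \<rightarrow>\<^bsub>G\<^esub> u'}"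
    by auto
  then have "real (H3_plus G W) = (\<Sum>t\<in>W \<times> W \<times> W \<times> W \<times> W \<times> W \<times> W.
     of_bool (case t of (x, y, z, u, v, u', x') \<Rightarrow>
     x \<rightarrow>\<^bsub>G\<^esub> y \<and> y \<rightarrow>\<^bsub>G\<^esub> z \<and> z \<rightarrow>\<^bsub>G\<^esub> u \<and> u \<rightarrow>\<^bsub>G\<^esub> x \<and> u \<rightarrow>\<^bsub>G\<^esub> v \<and> v \<rightarrow>\<^bsub>G\<^esub> u' \<and>
     u' \<rightarrow>\<^bsub>G\<^esub> z \<and> u' \<rightarrow>\<^bsub>G\<^esub> x' \<and> x' \<rightarrow>\<^bsub>G\<^esub> y \<and> x \<rightarrow>\<^bsub>G\<^esub> u'))"
    unfolding H3_plus_def using W by (simp only:) (rule card_filter_eq_sum, simp)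
  also have "\<dots> = (\<Sum>(y, u, u', x, z, v, x')\<in>W \<times> W \<times> W \<times> W \<times> W \<times> W \<times> W.
      (a y x * a u x * a u' x) * ((a y z * a u z * a u' z) * ((a u v * a v u') * (a u' x' * a x' y))))"
    by (rule sum.reindex_bij_witness[where i = "\<lambda>(y, u, u', x, z, v, x'). (x, y, z, u, v, u', x')"
          and j = "\<lambda>(x, y, z, u, v, u', x'). (y, u, u', x, z, v, x')"])
      (auto simp: of_bool_conj dominates_sym mult_ac)
  also have "\<dots> = (\<Sum>y\<in>W. \<Sum>u\<in>W. \<Sum>u'\<in>W. \<Sum>x\<in>W. \<Sum>z\<in>W. \<Sum>v\<in>W. \<Sum>x'\<in>W.
      (a y x * a u x * a u' x) * ((a y z * a u z * a u' z) * ((a u v * a v u') * (a u' x' * a x' y))))"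
    by (simp only: sum.cartesian_product)
  finally show ?thesis
    by (simp only: sum_distrib_left[symmetric] sum_distrib_right[symmetric])
qed

end

section \<open>From graphs to normalised kernels\<close>

lemma ndl_graph_degree_le:
  assumes "ndl_graph G n d lam" and "0 < n"
  shows "d \<le> n"
proof -
  interpret graph G using assms by (simp add: ndl_graph_def)
  obtain v where v: "v \<in> verts G"
    using assms by (metis all_not_in_conv card.empty less_irrefl ndl_graph_def)
  have "real d = (\<Sum>y\<in>verts G. of_bool (v \<rightarrow>\<^bsub>G\<^esub> y))"
    using sum_dominates_eq_out_degree[OF v] assms v by (simp add: ndl_graph_def)
  also have "\<dots> \<le> (\<Sum>y\<in>verts G. 1)"
    by (intro sum_mono) simp
  finally show ?thesis using assms by (simp add: ndl_graph_def)
qed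

text \<open>f is extended by zero outside \<open>U\<close>, and nonnegative outer terms are
  dropped.\<close>

lemma ndl_graph_mixing_on:
  assumes G: "ndl_graph G n d lam" and "0 < d" and "0 < n" and U: "U \<subseteq> verts G"
  shows "(\<Sum>x\<in>U. (\<Sum>y\<in>U. (of_bool (x \<rightarrow>\<^bsub>G\<^esub> y) - real d / real n) * f y)\<^sup>2)
      \<le> lam\<^sup>2 * (\<Sum>y\<in>U. (f y)\<^sup>2)"
proof -
  interpret graph G using G by (simp add: ndl_graph_def)
  define g where "g y = (if y \<in> U then f y else 0)" for y
  have restrict: "(\<Sum>y\<in>verts G. r y * g y) = (\<Sum>y\<in>U. r y * f y)" for r :: "_ \<Rightarrow> real"
    using U by (intro sum.mono_neutral_cong_right) (auto simp: g_def)
  have "(\<Sum>x\<in>U. (\<Sum>y\<in>U. (of_bool (x \<rightarrow>\<^bsub>G\<^esub> y) - real d / real n) * f y)\<^sup>2)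
      \<le> (\<Sum>x\<in>verts G. (\<Sum>y\<in>U. (of_bool (x \<rightarrow>\<^bsub>G\<^esub> y) - real d / real n) * f y)\<^sup>2)"
    using U by (intro sum_mono2) auto
  also have "\<dots> \<le> lam\<^sup>2 * (\<Sum>y\<in>verts G. (g y)\<^sup>2)"
    using ndl_graph_mixing(2)[OF assms(1-3), of g] by (simp add: restrict)
  also have "(\<Sum>y\<in>verts G. (g y)\<^sup>2) = (\<Sum>y\<in>U. (f y)\<^sup>2)"
    using U by (intro sum.mono_neutral_cong_right) (auto simp: g_def)
  finally show ?thesis .
qed

text \<open>The size hypothesis reads lam / m \<le> k p^(3/2). Since p \<le> 1 the power is at most
  p, and squaring gives p^3.\<close>

lemma powr_three_halves_le:
  fixes c lam m p k :: real
  assumes "0 < c" and "0 < p" and "p \<le> 1" and "0 < lam" and "0 < m" and "1 / c \<le> k"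
    and "c * (lam * (1 / p) powr (3 / 2)) \<le> m"
  shows "lam / m \<le> k * p" and "(lam / m)\<^sup>2 \<le> k\<^sup>2 * p ^ 3"
proof -
  define q where "q = p powr (3 / 2)"
  have q: "0 < q" using assms by (simp add: q_def)
  have "(1 / p) powr (3 / 2) = 1 / q"
    using assms by (simp add: q_def powr_divide)
  then have "c * lam / q \<le> m" using assms by simp
  then have "lam / m \<le> (1 / c) * q"
    using assms q by (simp add: field_simps)
  also have "\<dots> \<le> k * q" using assms q by (intro mult_right_mono) auto
  finally have le: "lam / m \<le> k * q" .
  have k: "0 < k" using assms by (smt (verit) divide_pos_pos)
  have "q \<le> p powr 1" unfolding q_def using assms by (intro powr_mono') auto
  then have "k * q \<le> k * p" using k assms by simp
  then show "lam / m \<le> k * p" using le by linarith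
  have "q\<^sup>2 = p powr (real 3)"
    unfolding q_def power2_eq_square by (simp flip: powr_add)
  also have "\<dots> = p ^ 3" using assms by (intro powr_realpow)
  finally have "q\<^sup>2 = p ^ 3" .
  moreover have "(lam / m)\<^sup>2 \<le> (k * q)\<^sup>2"
    using le assms by (intro power_mono) auto
  ultimately show "(lam / m)\<^sup>2 \<le> k\<^sup>2 * p ^ 3" by (simp add: power_mult_distrib)
qed

lemma H3_plus_bound:
  assumes G: "ndl_graph G n d lam" and d: "0 < d" and U: "U \<subseteq> verts G" "U \<noteq> {}"
    and c: "0 < c" and k: "1 \<le> k" "1 / c \<le> k"
    and large: "c * (lam * (real n / real d) powr (3 / 2)) \<le> real (card U)"
  shows "\<bar>real (H3_plus G U) - real (H3 G U) * real d / real n\<bar>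
            \<le> 50000 * k ^ 11 * (lam
                * sqrt (real (H2 G U) * (real (card U) * real d / real n))
                * sqrt (real (card U) ^ 6 * real d ^ 8 / real n ^ 8 + lam * real (H2 G U)))"
proof -
  interpret graph G using G by (simp add: ndl_graph_def)
  have gG: "graph G" by unfold_locales
  have finU: "finite U" using U finite_verts finite_subset by blast
  have n: "0 < n"
    using G U by (auto simp: ndl_graph_def card_gt_0_iff)
  define m p l where "m = real (card U)" and "p = real d / real n" and "l = lam / m"
  define a :: "_ \<Rightarrow> _ \<Rightarrow> real" where "a x y = of_bool (x \<rightarrow>\<^bsub>G\<^esub> y)" for x y
  have m: "0 < m" using finU U by (simp add: m_def card_gt_0_iff)
  have lam: "0 < lam" using ndl_graph_mixing(1)[OF G d n] .
  have p: "0 < p" "p \<le> 1"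
    using d n ndl_graph_degree_le[OF G n] by (auto simp: p_def)
  have "(1 / p) = real n / real d" by (simp add: p_def)
  then have l_bounds: "l \<le> k * p" "l\<^sup>2 \<le> k\<^sup>2 * p ^ 3"
    unfolding l_def using powr_three_halves_le[OF c p lam m k(2)] large by (simp_all add: m_def)
  interpret mixing_kernel U a p l k
  proof
    show "a x y = a y x" for x y
      using arcs_ends_symmetric[OF sym_arcs] by (auto simp: a_def)
    \<comment> \<open>The outer average costs m and the squared inner one m^2, so lam^2 / m^3
      becomes l^2 / m.\<close>
    fix f :: "'a \<Rightarrow> real"
    have "(\<Sum>x\<in>U. ((\<Sum>y\<in>U. (a x y - p) * f y) / real (card U))\<^sup>2) / real (card U)
        = (\<Sum>x\<in>U. (\<Sum>y\<in>U. (a x y - p) * f y)\<^sup>2) / m ^ 3"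
      by (simp add: m_def power_divide power2_eq_square power3_eq_cube flip: sum_divide_distrib)
    also have "\<dots> \<le> lam\<^sup>2 * (\<Sum>y\<in>U. (f y)\<^sup>2) / m ^ 3"
      using ndl_graph_mixing_on[OF G d n U(1), of f] m
      by (intro divide_right_mono) (auto simp: a_def p_def)
    also have "\<dots> = l\<^sup>2 * ((\<Sum>y\<in>U. (f y)\<^sup>2) / real (card U))"
      by (simp add: l_def m_def power2_eq_square power3_eq_cube)
    finally show "(\<Sum>x\<in>U. ((\<Sum>y\<in>U. (a x y - p) * f y) / real (card U))\<^sup>2) / real (card U)
        \<le> l\<^sup>2 * ((\<Sum>y\<in>U. (f y)\<^sup>2) / real (card U))" .
  qed (use finU U p l_bounds k lam m in \<open>auto simp: a_def l_def\<close>)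
  define S T where "S u v = (\<Sum>x\<in>U. a u x * a x v)" and "T y u v = (\<Sum>z\<in>U. a y z * a u z * a v z)"
    for u v y
  have codeg_S: "codeg u v = S u v / m" and codeg3_T: "codeg3 y u v = T y u v / m" for y u v
    by (simp_all add: codeg_def codeg3_def avg_def S_def T_def m_def)
  have avg_m: "avg f = (\<Sum>x\<in>U. f x) / m" for f by (simp add: avg_def m_def)
  have "real (H2 G U) = (\<Sum>u\<in>U. \<Sum>y\<in>U. S u y ^ 3)"
    unfolding H2_eq_sum[OF gG finU] S_def a_def ..
  then have h: "real (H2 G U) = m ^ 5 * h"
    using m by (simp add: h_def avg_m codeg_S power_divide field_simps eval_nat_numeral
        flip: sum_divide_distrib)
  have H3: "real (H3 G U) = (\<Sum>y\<in>U. \<Sum>u\<in>U. \<Sum>v\<in>U. S y u * (T y u v * (S u v * S v y)))"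
    unfolding H3_eq_sum[OF gG finU] S_def T_def a_def ..
  have H3p: "real (H3_plus G U) = (\<Sum>y\<in>U. \<Sum>u\<in>U. \<Sum>v\<in>U. T y u v * (T y u v * (S u v * S v y)))"
    unfolding H3_plus_eq_sum[OF gG finU] S_def T_def a_def ..
  have "real (H3_plus G U) - p * real (H3 G U)
      = (\<Sum>y\<in>U. \<Sum>u\<in>U. \<Sum>v\<in>U. T y u v * (T y u v * (S u v * S v y)) - p * (S y u * (T y u v * (S u v * S v y))))"
    by (simp add: H3 H3p sum_subtractf sum_distrib_left)
  \<comment> \<open>Four normalised counts give m^4; averaging over y, u, v supplies three further
    powers of m.\<close>
  also have "\<dots> = (\<Sum>y\<in>U. \<Sum>u\<in>U. \<Sum>v\<in>U. m ^ 4 * (codeg u v * codeg v y * codeg3 y u v * (codeg3 y u v - p * codeg y u)))"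
    using m by (intro sum.cong refl) (simp add: codeg_S codeg3_T field_simps eval_nat_numeral)
  also have "\<dots> = m ^ 4 * (\<Sum>y\<in>U. \<Sum>u\<in>U. \<Sum>v\<in>U. codeg u v * codeg v y * codeg3 y u v * (codeg3 y u v - p * codeg y u))"
    by (simp only: sum_distrib_left)
  also have "\<dots> = m ^ 7 * X"
    using m by (simp add: X_def avg_m eval_nat_numeral flip: sum_divide_distrib)
  finally have X: "real (H3_plus G U) - real (H3 G U) * real d / real n = m ^ 7 * X"
    by (simp add: p_def mult.commute)
  have m3: "sqrt (m ^ 6 * x) = m ^ 3 * sqrt x" for x
    using m real_sqrt_unique[of "m ^ 3" "m ^ 6"] by (simp add: real_sqrt_mult flip: power_mult)
  have "real (H2 G U) * (real (card U) * real d / real n) = m ^ 6 * (h * p)"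
    by (simp add: h p_def eval_nat_numeral flip: m_def)
  then have 1: "sqrt (real (H2 G U) * (real (card U) * real d / real n)) = m ^ 3 * sqrt (h * p)"
    by (simp only: m3)
  have "real (card U) ^ 6 * real d ^ 8 / real n ^ 8 + lam * real (H2 G U) = m ^ 6 * (p ^ 8 + l * h)"
    using m by (simp add: h p_def l_def power_divide field_simps eval_nat_numeral flip: m_def)
  then have 2: "sqrt (real (card U) ^ 6 * real d ^ 8 / real n ^ 8 + lam * real (H2 G U))
      = m ^ 3 * sqrt (p ^ 8 + l * h)"
    by (simp only: m3)
  have "\<bar>m ^ 7 * X\<bar> = m ^ 7 * \<bar>X\<bar>" using m by (simp add: abs_mult)
  also have "\<dots> \<le> m ^ 7 * (50000 * k ^ 11 * (l * sqrt (h * p) * sqrt (p ^ 8 + l * h)))"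
    using m by (intro mult_left_mono abs_X_bound) auto
  \<comment> \<open>m^7 splits as m for l m = lam and m^3 for each square root.\<close>
  also have "\<dots> = 50000 * k ^ 11 * (lam * (m ^ 3 * sqrt (h * p)) * (m ^ 3 * sqrt (p ^ 8 + l * h)))"
    using m by (simp add: l_def eval_nat_numeral)
  finally show ?thesis unfolding X 1 2 .
qed

theorem theorem3p6:
  fixes c :: real
  assumes "c > 0"
  shows "\<exists>(C :: real) (\<epsilon> :: nat \<Rightarrow> real). \<epsilon> \<longlonglongrightarrow> 0 \<and>
    (\<forall>(G :: ('a, 'b) pre_digraph) n d lam U.
       ndl_graph G n d lam \<longrightarrow> U \<subseteq> verts G \<longrightarrow>
       real (card U) \<ge> c * (lam * (real n / real d) powr (3 / 2)) \<longrightarrow>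
       (\<exists>U' \<subseteq> U.
          real (card U') \<ge> (1 - \<epsilon> n) * real (card U) \<and>
          \<bar>real (H3_plus G U') - real (H3 G U') * real d / real n\<bar>
            \<le> C * (lam
                * sqrt (real (H2 G U') * (real (card U') * real d / real n))
                * sqrt (real (card U') ^ 6 * real d ^ 8 / real n ^ 8 + lam * real (H2 G U')))))"
proof -
  \<comment> \<open>The maximum with 1 secures the monotonicity in powers of \<open>k\<close> on
    which \<open>mono_kp\<close> rests.\<close>
  define k where "k = max 1 (1 / c)"
  have k: "1 \<le> k" "1 / c \<le> k" by (auto simp: k_def)
  have bound: "\<bar>real (H3_plus G U) - real (H3 G U) * real d / real n\<bar>
            \<le> 50000 * k ^ 11 * (lam
                * sqrt (real (H2 G U) * (real (card U) * real d / real n))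
                * sqrt (real (card U) ^ 6 * real d ^ 8 / real n ^ 8 + lam * real (H2 G U)))"
    if G: "ndl_graph G n d lam" and U: "U \<subseteq> verts G"
      and large: "real (card U) \<ge> c * (lam * (real n / real d) powr (3 / 2))"
    for G :: "('a, 'b) pre_digraph" and n d lam U
  \<comment> \<open>Both sides vanish here: there is no edge or no vertex, and the right side
    contains the factor sqrt (H2 * (card U * d / n)).\<close>
  proof (cases "d = 0 \<or> U = {}")
    case True
    interpret graph G using G by (simp add: ndl_graph_def)
    have "out_arcs G v = {}" if "d = 0" "v \<in> verts G" for v
    proof -
      have "card (out_arcs G v) = 0"
        using G that by (simp add: ndl_graph_def out_degree_def)
      then show ?thesis using finite_out_arcs[of v] by simp
    qed
    then have "\<not> x \<rightarrow>\<^bsub>G\<^esub> y" if "d = 0" for x y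
      using that by (force simp: arcs_ends_conv out_arcs_def)
    then have "H3_plus G U = 0" "d = 0 \<or> H3 G U = 0"
      using True by (auto simp: H3_plus_def H3_def)
    then show ?thesis using True by auto
  next
    case False
    then show ?thesis
      using H3_plus_bound[OF G _ U _ assms k large] by simp
  qed
  \<comment> \<open>\<open>U\<close> itself serves as \<open>U'\<close>, with loss
    \<open>\<epsilon>\<close> identically 0.\<close>
  show ?thesis
    using bound
    by (intro exI[of _ "50000 * k ^ 11"] exI[of _ "\<lambda>_. 0"] conjI allI impI exI[of _ U for U]) auto
qed

end
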